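(* Let $\mathfrak C:X'Y'\to Z$ be a quantum multiple access channel (a quantum channel from $X'\otimes Y'$ to $Z$, finite-dimensional). Let $\mathcal X,\mathcal Y$ be finite sets, for each $x\in\mathcal X$ let $\sigma_x^{X'}$ be a state on $X'$ and for each $y\in\mathcal Y$ let $\sigma^{Y'}_y$ be a state on $Y'$, and let $p(x)p(y)$ be a product probability distribution on $\mathcal X\times\mathcal Y$. Let $$\rho^{XYZ}:=\sum_{x,y}p(x)p(y)|x,y\rangle\langle x,y|^{XY}\otimes\mathfrak C(\sigma^{X'}_x\otimes\sigma^{Y'}_y).$$ Let $0<\epsilon<1$ and $R_1,R_2$ satisfy $R_1\le I^\epsilon_H(X:YZ)_\rho-1-\log\frac1\epsilon$, $R_2\le I^\epsilon_H(Y:XZ)_\rho-1-\log\frac1\epsilon$, $R_1+R_2\le I^\epsilon_H(XY:Z)_\rho-1-\log\frac1\epsilon$. Then there exists an $(R_1,R_2,49\epsilon^{1/2})$-quantum MAC code for sending classical information through $\mathfrak C$.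
   Context: $I^\epsilon_H(X:YZ)_\rho:=D^\epsilon_H(\rho^{XYZ}\|\rho^X\otimes\rho^{YZ})$, $I^\epsilon_H(Y:XZ)_\rho:=D^\epsilon_H(\rho^{XYZ}\|\rho^Y\otimes\rho^{XZ})$, $I^\epsilon_H(XY:Z)_\rho:=D^\epsilon_H(\rho^{XYZ}\|\rho^{XY}\otimes\rho^Z)$, where $D^\epsilon_H(\alpha\|\beta):=\max_\Pi -\log_2\operatorname{Tr}[\Pi\beta]$ over POVM elements $0\le\Pi\le\mathbb 1$ with $\operatorname{Tr}[\Pi\alpha]\ge1-\epsilon$; logs are base 2. An $(R_1,R_2,\eta)$-quantum MAC code for classical information through $\mathfrak C$ consists of an encoding of each message $m_1\in[2^{R_1}]$ into a state $\alpha_{m_1}$ on $X'$, of each $m_2\in[2^{R_2}]$ into a state $\beta_{m_2}$ on $Y'$, and a POVM $\{\Lambda_{m_1,m_2}\}$ on $Z$ such that the average decoding error $2^{-(R_1+R_2)}\sum_{m_1,m_2}\operatorname{Tr}[(\mathbb 1-\Lambda_{m_1,m_2})\mathfrak C(\alpha_{m_1}\otimes\beta_{m_2})]$ is at most $\eta$. *)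

theory Defs
  imports Complex_Main "HOL-Library.Extended_Real"
begin

text \<open>Operators on a finite-dimensional Hilbert space with orthonormal basis indexed by
  a type 'i are represented by their matrices  'i => 'i => complex.\<close>
type_synonym 'i op = "'i \<Rightarrow> 'i \<Rightarrow> complex"

text \<open>Positive semidefinite on the span of the basis vectors in a finite index set S
  (over the complex numbers this includes hermiticity).\<close>
definition psd_on :: "'i set \<Rightarrow> 'i op \<Rightarrow> bool" where
  "psd_on S A \<longleftrightarrow> (\<forall>v :: 'i \<Rightarrow> complex.
      (\<Sum>i\<in>S. \<Sum>j\<in>S. cnj (v i) * A i j * v j) \<in> \<real> \<and>
      0 \<le> Re (\<Sum>i\<in>S. \<Sum>j\<in>S. cnj (v i) * A i j * v j))"

definition psd :: "('i::finite) op \<Rightarrow> bool" where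
  "psd A \<longleftrightarrow> psd_on UNIV A"

definition trace :: "('i::finite) op \<Rightarrow> complex" where
  "trace A = (\<Sum>i\<in>UNIV. A i i)"

definition density :: "('i::finite) op \<Rightarrow> bool" where
  "density A \<longleftrightarrow> psd A \<and> trace A = 1"

definition idop :: "'i op" where
  "idop i j = (if i = j then 1 else 0)"

definition opmult :: "('i::finite) op \<Rightarrow> 'i op \<Rightarrow> 'i op" where
  "opmult A B i j = (\<Sum>k\<in>UNIV. A i k * B k j)"

definition opminus :: "'i op \<Rightarrow> 'i op \<Rightarrow> 'i op" where
  "opminus A B i j = A i j - B i j"

definition tensor :: "'i op \<Rightarrow> 'j op \<Rightarrow> ('i \<times> 'j) op" where
  "tensor A B = (\<lambda>(i, j) (i', j'). A i i' * B j j')"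

definition proj :: "'i \<Rightarrow> 'i op" where
  "proj x i j = (if i = x \<and> j = x then 1 else 0)"

definition ptrace2 :: "('i \<times> 'j::finite) op \<Rightarrow> 'i op" where
  "ptrace2 A i i' = (\<Sum>j\<in>UNIV. A (i, j) (i', j))"

definition ptrace1 :: "('i::finite \<times> 'j) op \<Rightarrow> 'j op" where
  "ptrace1 A j j' = (\<Sum>i\<in>UNIV. A (i, j) (i, j'))"

text \<open>Quantum channels (CPTP maps) between finite-dimensional systems.
  Complete positivity: for every ancilla dimension n (ancilla basis {..<n}),
  id_n (x) C maps positive operators to positive operators.\<close>
definition completely_positive :: "(('i::finite) op \<Rightarrow> ('k::finite) op) \<Rightarrow> bool" where
  "completely_positive C \<longleftrightarrow> (\<forall>(n::nat) (A :: (nat \<times> 'i) op).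
      psd_on ({..<n} \<times> UNIV) A \<longrightarrow>
      psd_on ({..<n} \<times> UNIV) (\<lambda>(r, k) (r', k'). C (\<lambda>a b. A (r, a) (r', b)) k k'))"

definition quantum_channel :: "(('i::finite) op \<Rightarrow> ('k::finite) op) \<Rightarrow> bool" where
  "quantum_channel C \<longleftrightarrow>
     (\<forall>A B. C (\<lambda>i j. A i j + B i j) = (\<lambda>k l. C A k l + C B k l)) \<and>
     (\<forall>c A. C (\<lambda>i j. c * A i j) = (\<lambda>k l. c * C A k l)) \<and>
     (\<forall>A. trace (C A) = trace A) \<and>
     completely_positive C"

text \<open>Hypothesis-testing relative entropy (logs base 2); value +infinity if Tr[Pi beta] = 0.
  The supremum is attained (the paper writes max).\<close>
definition DH :: "real \<Rightarrow> ('i::finite) op \<Rightarrow> 'i op \<Rightarrow> ereal" where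
  "DH \<epsilon> \<alpha> \<beta> = (SUP \<Pi> \<in> {\<Pi>. psd \<Pi> \<and> psd (opminus idop \<Pi>) \<and>
                               Re (trace (opmult \<Pi> \<alpha>)) \<ge> 1 - \<epsilon>}.
       (if Re (trace (opmult \<Pi> \<beta>)) > 0 then ereal (- log 2 (Re (trace (opmult \<Pi> \<beta>))))
        else PInfty))"

definition mac_state :: "('x::finite \<Rightarrow> real) \<Rightarrow> ('y::finite \<Rightarrow> real) \<Rightarrow>
    ('x \<Rightarrow> 'a op) \<Rightarrow> ('y \<Rightarrow> 'b op) \<Rightarrow> (('a \<times> 'b) op \<Rightarrow> 'z op) \<Rightarrow> ('x \<times> 'y \<times> 'z) op" where
  "mac_state p q \<sigma>X \<sigma>Y C = (\<lambda>i j. \<Sum>x\<in>UNIV. \<Sum>y\<in>UNIV.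
      complex_of_real (p x * q y) * tensor (proj x) (tensor (proj y) (C (tensor (\<sigma>X x) (\<sigma>Y y)))) i j)"

definition IH_X_YZ :: "real \<Rightarrow> ('x::finite \<times> 'y::finite \<times> 'z::finite) op \<Rightarrow> ereal" where
  "IH_X_YZ \<epsilon> \<rho> = DH \<epsilon> \<rho> (tensor (ptrace2 \<rho>) (ptrace1 \<rho>))"

definition IH_Y_XZ :: "real \<Rightarrow> ('x::finite \<times> 'y::finite \<times> 'z::finite) op \<Rightarrow> ereal" where
  "IH_Y_XZ \<epsilon> \<rho> = (let \<rho>' = (\<lambda>(y, x, z) (y', x', z'). \<rho> (x, y, z) (x', y', z'))
                    in DH \<epsilon> \<rho>' (tensor (ptrace2 \<rho>') (ptrace1 \<rho>')))"

definition IH_XY_Z :: "real \<Rightarrow> ('x::finite \<times> 'y::finite \<times> 'z::finite) op \<Rightarrow> ereal" where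
  "IH_XY_Z \<epsilon> \<rho> = (let \<rho>' = (\<lambda>((x, y), z) ((x', y'), z'). \<rho> (x, y, z) (x', y', z'))
                    in DH \<epsilon> \<rho>' (tensor (ptrace2 \<rho>') (ptrace1 \<rho>')))"

text \<open>An (R1,R2,eta) quantum MAC code with M1 = 2^R1, M2 = 2^R2 messages
  (messages m1 < M1, m2 < M2).\<close>
definition mac_code :: "(('a::finite \<times> 'b::finite) op \<Rightarrow> ('z::finite) op) \<Rightarrow> nat \<Rightarrow> nat \<Rightarrow> real \<Rightarrow>
    (nat \<Rightarrow> 'a op) \<Rightarrow> (nat \<Rightarrow> 'b op) \<Rightarrow> (nat \<Rightarrow> nat \<Rightarrow> 'z op) \<Rightarrow> bool" where
  "mac_code C M1 M2 \<eta> \<alpha> \<beta> \<Lambda> \<longleftrightarrow>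
     (\<forall>m1<M1. density (\<alpha> m1)) \<and> (\<forall>m2<M2. density (\<beta> m2)) \<and>
     (\<forall>m1<M1. \<forall>m2<M2. psd (\<Lambda> m1 m2)) \<and>
     (\<forall>i j. (\<Sum>m1<M1. \<Sum>m2<M2. \<Lambda> m1 m2 i j) = idop i j) \<and>
     (1 / (real M1 * real M2)) * (\<Sum>m1<M1. \<Sum>m2<M2.
        Re (trace (opmult (opminus idop (\<Lambda> m1 m2)) (C (tensor (\<alpha> m1) (\<beta> m2)))))) \<le> \<eta>"

end

theory Submission
  imports Defs "HOL-Library.Function_Algebras" "HOL-Library.FuncSet"
begin

text \<open>
  A decoder has to reject three kinds of competitors: wrong first message, wrong second message, both
  wrong.  The hypotheses give one test against each kind, but non-commuting tests have no
  intersection: the span of three rejection subspaces may come close to the correct signal although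
  each of them is far from it.  Following Sen, the rejection subspaces are therefore tilted by a small
  angle \<open>\<delta>\<close> into fresh orthogonal directions, which makes their span well conditioned.  Here the
  directions are indexed by the messages themselves.  The signal of \<open>(m\<^sub>1, m\<^sub>2)\<close> is tilted along \<open>m\<^sub>1\<close>
  and \<open>m\<^sub>2\<close>; the rejection subspace against a wrong \<open>m\<^sub>1\<close> is tilted along \<open>m\<^sub>2\<close> and vice versa, and
  that against both wrong is not tilted.  A competing test then sees a wrong signal with exactly the
  tilt of the matching rejection subspace, so that its error is at most \<open>1 + \<delta>\<^sup>2\<close> times that of the
  original test, while the correct signal is lost with probability \<open>O(\<epsilon> / \<delta>\<^sup>2)\<close>.

  The joint tests are applied one after the other; by a non-commutative union bound the failure
  probability is at most four times the sum of the individual ones.  Undoing the tilt of the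
  signal costs \<open>O(\<delta>\<^sup>2)\<close>.  All these are inequalities between quadratic forms valid for each codebook, so
  only the classical average over the codebooks remains.  The choice \<open>\<delta>\<^sup>2 = 4 \<surd>\<epsilon>\<close> gives the bound.
\<close>

section \<open>Complex-linear maps on coordinate vectors\<close>

definition csc :: "complex \<Rightarrow> ('i \<Rightarrow> complex) \<Rightarrow> 'i \<Rightarrow> complex" where
  "csc c v = (\<lambda>i. c * v i)"

definition clinear_map :: "(('i \<Rightarrow> complex) \<Rightarrow> 'j \<Rightarrow> complex) \<Rightarrow> bool" where
  "clinear_map F \<longleftrightarrow> (\<forall>u v. F (u + v) = F u + F v) \<and> (\<forall>c v. F (csc c v) = csc c (F v))"

definition unitvec :: "'i \<Rightarrow> 'i \<Rightarrow> complex" where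
  "unitvec i = (\<lambda>j. if j = i then 1 else 0)"

lemma csc_apply [simp]: "csc c v i = c * v i"
  by (simp add: csc_def)

lemma csc_zero [simp]: "csc c 0 = 0" "csc 0 v = 0"
  by (auto simp: fun_eq_iff)

lemma csc_one [simp]: "csc 1 v = v"
  by (auto simp: fun_eq_iff)

lemma csc_diff: "csc c (u - v) = csc c u - csc c v"
  by (auto simp: fun_eq_iff algebra_simps)

lemma diff_eq_add_csc: "u - v = u + csc (-1) v"
  by (auto simp: fun_eq_iff)

lemma clinear_map_add: "clinear_map F \<Longrightarrow> F (u + v) = F u + F v"
  and clinear_map_csc: "clinear_map F \<Longrightarrow> F (csc c v) = csc c (F v)"
  by (auto simp: clinear_map_def)

lemma clinear_map_zero: "clinear_map F \<Longrightarrow> F 0 = 0"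
  using clinear_map_csc[of F 0 0] by simp

lemma clinear_map_compl: "clinear_map F \<Longrightarrow> clinear_map (\<lambda>v. v - F v)"
  unfolding clinear_map_def by (auto simp: csc_diff)

lemma clinear_map_comp: "clinear_map F \<Longrightarrow> clinear_map G \<Longrightarrow> clinear_map (\<lambda>v. F (G v))"
  by (simp add: clinear_map_def)

section \<open>Positive semidefinite sesquilinear forms\<close>

locale psd_form =
  fixes B :: "('i \<Rightarrow> complex) \<Rightarrow> ('i \<Rightarrow> complex) \<Rightarrow> complex"
  assumes add_right: "B u (v + w) = B u v + B u w"
    and csc_right: "B u (csc c v) = c * B u v"
    and herm: "cnj (B u v) = B v u"
    and nonneg: "0 \<le> Re (B v v)"
begin

lemma add_left: "B (u + v) w = B u w + B v w"
  by (metis add_right herm complex_cnj_add)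

lemma csc_left: "B (csc c u) v = cnj c * B u v"
  by (metis csc_right herm complex_cnj_mult)

lemma diff_right: "B u (v - w) = B u v - B u w"
  by (simp add: diff_eq_add_csc add_right csc_right)

lemma diff_left: "B (u - v) w = B u w - B v w"
  by (simp add: diff_eq_add_csc add_left csc_left)

lemma zero_right: "B u 0 = 0"
  using csc_right[of u 0 0] by simp

lemma zero_left: "B 0 u = 0"
  using csc_left[of 0 0 u] by simp

lemmas sesq = add_left add_right diff_left diff_right csc_left csc_right zero_left zero_right

lemma diag_real: "B v v = complex_of_real (Re (B v v))"
  by (metis Reals_cnj_iff herm of_real_Re)

lemma Re_sym: "Re (B u v) = Re (B v u)"
  by (metis cnj.simps(1) herm)

text \<open>Positivity at \<open>u - c v\<close>, with \<open>c\<close> equal to \<open>t\<close>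
  times the conjugate of \<open>B u v\<close>, is a quadratic inequality in the real
  \<open>t\<close>. If \<open>B v v\<close> is nonzero, \<open>t = 1 / B v v\<close> is optimal;
  otherwise the inequality is affine in \<open>t\<close> and forces
  \<open>B u v = 0\<close>.\<close>

lemma cauchy_schwarz: "(cmod (B u v))\<^sup>2 \<le> Re (B u u) * Re (B v v)"
proof -
  define b where "b = B u v"
  have bv: "B v u = cnj b" by (simp add: b_def herm)
  have main: "0 \<le> Re (B u u) - 2 * t * (cmod b)\<^sup>2 + t\<^sup>2 * (cmod b)\<^sup>2 * Re (B v v)" for t :: real
  proof -
    define c where "c = complex_of_real t * cnj b"
    have "0 \<le> Re (B (u - csc c v) (u - csc c v))" by (rule nonneg)
    also have "B (u - csc c v) (u - csc c v)
        = B u u - (c * b + cnj c * cnj b) + c * cnj c * B v v"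
      by (simp add: sesq bv flip: b_def) (simp add: algebra_simps)
    also have "c * b = complex_of_real (t * (cmod b)\<^sup>2)"
      using complex_norm_square[of b] by (simp add: c_def mult_ac)
    also have "cnj c * cnj b = complex_of_real (t * (cmod b)\<^sup>2)"
      using complex_norm_square[of b] by (simp add: c_def mult_ac)
    also have "c * cnj c = complex_of_real (t\<^sup>2 * (cmod b)\<^sup>2)"
      using complex_norm_square[of b] by (simp add: c_def power2_eq_square mult_ac)
    finally show ?thesis by (simp add: algebra_simps)
  qed
  show ?thesis
  proof (cases "Re (B v v) = 0")
    case True
    have "(cmod b)\<^sup>2 = 0"
    proof (rule ccontr)
      assume ne: "(cmod b)\<^sup>2 \<noteq> 0"
      \<comment> \<open>This \<open>t\<close> gives the affine function the value -1.\<close>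
      have "0 \<le> Re (B u u) - 2 * ((Re (B u u) + 1) / (2 * (cmod b)\<^sup>2)) * (cmod b)\<^sup>2"
        using main[of "(Re (B u u) + 1) / (2 * (cmod b)\<^sup>2)"] True by simp
      also have "\<dots> = -1" using ne by (simp add: field_simps)
      finally show False by simp
    qed
    then show ?thesis using True by (simp add: b_def)
  next
    case False
    then have pos: "Re (B v v) > 0" using nonneg[of v] by linarith
    show ?thesis using main[of "1 / Re (B v v)"] pos
      by (simp add: b_def field_simps power2_eq_square)
  qed
qed

lemma null_right: "Re (B v v) = 0 \<Longrightarrow> B u v = 0"
  using cauchy_schwarz[of u v] by simp

lemma null_left: "Re (B v v) = 0 \<Longrightarrow> B v u = 0"
  using cauchy_schwarz[of v u] by simp

text \<open>Positivity at \<open>u - t v\<close>, divided by \<open>t\<close>. The free weight lets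
  a cross term be absorbed with a prescribed small coefficient.\<close>

lemma Re_le_weighted:
  assumes "t > 0"
  shows "2 * Re (B u v) \<le> t * Re (B v v) + Re (B u u) / t"
proof -
  have "0 \<le> Re (B (u - csc (of_real t) v) (u - csc (of_real t) v))" by (rule nonneg)
  also have "\<dots> = Re (B u u) - 2 * t * Re (B u v) + t\<^sup>2 * Re (B v v)"
    using Re_sym[of u v] by (simp add: sesq power2_eq_square algebra_simps)
  finally show ?thesis using assms by (simp add: field_simps power2_eq_square)
qed

text \<open>The difference of the two sides is the value of the form at
  \<open>2 v - u\<close>.\<close>

lemma le_twice: "Re (B u u) \<le> 2 * Re (B v v) + 2 * Re (B (v - u) (v - u))"
proof -
  have "0 \<le> Re (B (csc 2 v - u) (csc 2 v - u))" by (rule nonneg)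
  then show ?thesis using Re_sym[of u v] by (simp add: sesq)
qed

lemma sum_left: "finite S \<Longrightarrow> B (\<lambda>i. \<Sum>k\<in>S. f k i) v = (\<Sum>k\<in>S. B (f k) v)"
proof (induction S rule: finite_induct)
  case empty
  then show ?case using zero_left[of v] by (simp add: zero_fun_def)
next
  case (insert k S)
  have "(\<lambda>i. \<Sum>l\<in>insert k S. f l i) = f k + (\<lambda>i. \<Sum>l\<in>S. f l i)"
    using insert by (auto simp: fun_eq_iff)
  then show ?case using insert by (simp add: add_left)
qed

end

section \<open>Closure properties and partial minimisation of forms\<close>

lemma psd_form_add:
  assumes "psd_form A" "psd_form B"
  shows "psd_form (\<lambda>u v. A u v + B u v)"
proof -
  interpret A: psd_form A by fact
  interpret B: psd_form B by fact
  show ?thesis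
    by unfold_locales (auto simp: A.sesq B.sesq A.herm B.herm A.nonneg B.nonneg algebra_simps)
qed

lemma psd_form_scale:
  assumes "psd_form A" "c \<ge> 0"
  shows "psd_form (\<lambda>u v. complex_of_real c * A u v)"
proof -
  interpret A: psd_form A by fact
  show ?thesis
    by unfold_locales (auto simp: A.sesq A.herm A.nonneg assms algebra_simps)
qed

lemma psd_form_sum:
  assumes "\<And>k. k \<in> S \<Longrightarrow> psd_form (A k)"
  shows "psd_form (\<lambda>u v. \<Sum>k\<in>S. A k u v)"
proof (cases "finite S")
  case True
  then show ?thesis using assms
  proof (induction S rule: finite_induct)
    case empty
    then show ?case by unfold_locales auto
  next
    case (insert k S)
    then show ?case using psd_form_add[of "A k" "\<lambda>u v. \<Sum>k\<in>S. A k u v"] by simp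
  qed
next
  case False
  then show ?thesis by unfold_locales auto
qed

lemma psd_form_diff:
  assumes "psd_form A" "psd_form B" "\<And>v. Re (B v v) \<le> Re (A v v)"
  shows "psd_form (\<lambda>u v. A u v - B u v)"
proof -
  interpret A: psd_form A by fact
  interpret B: psd_form B by fact
  show ?thesis
    by unfold_locales (use assms(3) in \<open>auto simp: A.sesq B.sesq A.herm B.herm algebra_simps\<close>)
qed

lemma psd_form_comp:
  assumes "psd_form A" "clinear_map F"
  shows "psd_form (\<lambda>u v. A (F u) (F v))"
proof -
  interpret A: psd_form A by fact
  show ?thesis
    by unfold_locales
      (auto simp: A.sesq A.herm A.nonneg clinear_map_add[OF assms(2)] clinear_map_csc[OF assms(2)])
qed

text \<open>Schur complement with respect to a single vector; if \<^term>\<open>B e e = 0\<close> then \<^term>\<open>B u e = 0\<close>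
  as well, and the convention \<open>x / 0 = 0\<close> gives back \<^term>\<open>B\<close>.\<close>

lemma psd_form_eliminate_vector:
  assumes "psd_form B"
  obtains B' where "psd_form B'"
    "\<And>u v. B' u v = B u v - B u e * B e v / B e e"
    "\<And>v c. Re (B' v v) \<le> Re (B (v + csc c e) (v + csc c e))"
    "\<And>v. \<exists>c. Re (B' v v) = Re (B (v + csc c e) (v + csc c e))"
proof -
  interpret psd_form B by fact
  define r where "r = Re (B e e)"
  have r: "B e e = of_real r" "r \<ge> 0" using diag_real nonneg by (auto simp: r_def)
  define B' where "B' = (\<lambda>u v. B u v - B u e * B e v / of_real r)"
  have sq: "B v e * B e v = of_real ((cmod (B e v))\<^sup>2)" for v
    using complex_norm_square[of "B e v"] herm[of e v] by (simp add: mult_ac)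
  have diag: "Re (B' v v) = Re (B v v) - (cmod (B e v))\<^sup>2 / r" for v
    by (simp add: B'_def sq flip: of_real_divide)
  \<comment> \<open>Completing the square in \<open>c\<close>: the minimum over \<open>c\<close> is
    \<open>B'\<close>, attained at \<open>c = - B e v / r\<close>. If \<open>r = 0\<close>, the
    cross terms vanish by Cauchy-Schwarz and every \<open>c\<close> is a minimiser.\<close>
  have key: "Re (B (v + csc c e) (v + csc c e))
      = Re (B' v v) + r * (cmod (c + B e v / of_real r))\<^sup>2" for v c
  proof (cases "r = 0")
    case True
    then have "B u e = 0" "B e u = 0" for u
      using null_left[of e u] null_right[of e u] by (simp_all add: r_def)
    then show ?thesis using True by (simp add: diag sesq)
  next
    case False
    define b where "b = B e v"
    have b': "B v e = cnj b" by (simp add: b_def herm)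
    have "complex_of_real (r * (cmod (c + b / of_real r))\<^sup>2)
        = of_real r * ((c + b / of_real r) * cnj (c + b / of_real r))"
      by (simp only: of_real_mult complex_norm_square)
    also have "\<dots> = of_real r * c * cnj c + c * cnj b + cnj c * b + b * cnj b / of_real r"
      using False by (simp add: field_simps)
    finally have e1: "r * (cmod (c + b / of_real r))\<^sup>2
        = Re (of_real r * c * cnj c + c * cnj b + cnj c * b + b * cnj b / of_real r)"
      by (metis Re_complex_of_real)
    have "B (v + csc c e) (v + csc c e) = B v v + c * cnj b + cnj c * b + of_real r * c * cnj c"
      by (simp add: sesq r b' flip: b_def) (simp add: algebra_simps)
    moreover have "B' v v = B v v - b * cnj b / of_real r"
      by (simp add: B'_def b' flip: b_def)
    ultimately show ?thesis using e1 by (simp flip: b_def)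
  qed
  show ?thesis
  proof
    show "psd_form B'"
    proof
      fix v
      have "(cmod (B e v))\<^sup>2 / r \<le> Re (B v v)"
        using cauchy_schwarz[of e v] \<open>r \<ge> 0\<close> nonneg[of v] unfolding r_def[symmetric]
        by (cases "r = 0") (simp_all add: pos_divide_le_eq mult.commute)
      then show "0 \<le> Re (B' v v)" by (simp add: diag)
    qed (simp_all add: B'_def sesq herm algebra_simps add_divide_distrib)
    show "B' u v = B u v - B u e * B e v / B e e" for u v
      by (simp add: B'_def r(1))
    show "Re (B' v v) \<le> Re (B (v + csc c e) (v + csc c e))" for v c
      using r by (simp add: key)
    show "\<exists>c. Re (B' v v) = Re (B (v + csc c e) (v + csc c e))" for v
      by (rule exI[of _ "- B e v / of_real r"]) (simp add: key)
  qed
qed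

text \<open>Minimising a form over finitely many coordinates, one Schur complement per coordinate.
  The result is again a form, and the minimum is attained; both facts are kept because lower bounds
  are later read off at a minimiser and upper bounds at trial points.\<close>

lemma psd_form_eliminate_coordinates:
  assumes "finite J" "psd_form B"
  shows "\<exists>B'. psd_form B' \<and>
    (\<forall>v. (\<forall>w. (\<forall>i. i \<notin> J \<longrightarrow> w i = 0) \<longrightarrow> Re (B' v v) \<le> Re (B (v + w) (v + w))) \<and>
         (\<exists>w. (\<forall>i. i \<notin> J \<longrightarrow> w i = 0) \<and> Re (B' v v) = Re (B (v + w) (v + w))))"
  using assms(1)
proof (induction J rule: finite_induct)
  case empty
  have "w = 0" if "\<forall>i. w i = 0" for w :: "'a \<Rightarrow> complex"
    using that by (auto simp: fun_eq_iff)
  then show ?case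
    by (intro exI[of _ B]) (auto simp: assms(2) intro!: exI[of _ 0])
next
  case (insert j J)
  then obtain B1 where B1: "psd_form B1"
    and le1: "\<And>v w. (\<And>i. i \<notin> J \<Longrightarrow> w i = 0) \<Longrightarrow> Re (B1 v v) \<le> Re (B (v + w) (v + w))"
    and ex1: "\<And>v. \<exists>w. (\<forall>i. i \<notin> J \<longrightarrow> w i = 0) \<and> Re (B1 v v) = Re (B (v + w) (v + w))"
    by blast
  obtain B2 where B2: "psd_form B2"
    and le2: "\<And>v c. Re (B2 v v) \<le> Re (B1 (v + csc c (unitvec j)) (v + csc c (unitvec j)))"
    and ex2: "\<And>v. \<exists>c. Re (B2 v v) = Re (B1 (v + csc c (unitvec j)) (v + csc c (unitvec j)))"
    using psd_form_eliminate_vector[OF B1] by metis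
  show ?case
  proof (intro exI[of _ B2] conjI allI impI B2)
    fix v w :: "'a \<Rightarrow> complex"
    assume w: "\<forall>i. i \<notin> insert j J \<longrightarrow> w i = 0"
    define w' where "w' = w(j := 0)"
    \<comment> \<open>The coordinate \<open>j\<close> of \<open>w\<close> belongs to the newest
      elimination, the others to the induction hypothesis.\<close>
    have dec: "v + w = (v + csc (w j) (unitvec j)) + w'"
      by (auto simp: fun_eq_iff w'_def unitvec_def)
    have "Re (B2 v v) \<le> Re (B1 (v + csc (w j) (unitvec j)) (v + csc (w j) (unitvec j)))"
      by (rule le2)
    also have "\<dots> \<le> Re (B (v + w) (v + w))"
      unfolding dec by (rule le1) (use w in \<open>auto simp: w'_def\<close>)
    finally show "Re (B2 v v) \<le> Re (B (v + w) (v + w))" .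
  next
    fix v :: "'a \<Rightarrow> complex"
    obtain c where c: "Re (B2 v v) = Re (B1 (v + csc c (unitvec j)) (v + csc c (unitvec j)))"
      using ex2 by blast
    obtain w where w: "\<forall>i. i \<notin> J \<longrightarrow> w i = 0"
      and eq: "Re (B1 (v + csc c (unitvec j)) (v + csc c (unitvec j)))
        = Re (B (v + csc c (unitvec j) + w) (v + csc c (unitvec j) + w))"
      using ex1 by blast
    show "\<exists>w. (\<forall>i. i \<notin> insert j J \<longrightarrow> w i = 0) \<and> Re (B2 v v) = Re (B (v + w) (v + w))"
      by (rule exI[of _ "csc c (unitvec j) + w"])
        (use w c eq in \<open>auto simp: unitvec_def add.assoc\<close>)
  qed
qed

text \<open>The sum on the right is a single positive semidefinite form in the pair
  \<open>(z, w)\<close>, and minimising over \<open>w\<close> is an elimination of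
  coordinates.\<close>

lemma psd_form_inf_convolution:
  fixes s :: "('j::finite \<Rightarrow> complex) \<Rightarrow> 'i \<Rightarrow> complex"
  assumes B: "psd_form B" and \<kappa>: "psd_form \<kappa>" and s: "clinear_map s"
  obtains B' where "psd_form B'"
    "\<And>z w. Re (B' z z) \<le> Re (B (z - s w) (z - s w)) + Re (\<kappa> w w)"
    "\<And>z. \<exists>w. Re (B' z z) = Re (B (z - s w) (z - s w)) + Re (\<kappa> w w)"
proof -
  \<comment> \<open>A pair is stored as one vector on the disjoint union of the index types:
    \<open>I\<close> embeds \<open>z\<close> with \<open>w = 0\<close>, \<open>R\<close> reads off
    \<open>w\<close>, and \<open>L\<close> gives \<open>z - s w\<close>.\<close>
  define L where "L = (\<lambda>f::'i + 'j \<Rightarrow> complex. (\<lambda>i. f (Inl i)) - s (\<lambda>j. f (Inr j)))"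
  define R where "R = (\<lambda>(f::'i + 'j \<Rightarrow> complex) j. f (Inr j))"
  define I where "I = (\<lambda>(z::'i \<Rightarrow> complex) k. case k of Inl i \<Rightarrow> z i | Inr (j::'j) \<Rightarrow> 0)"
  have R: "clinear_map R" by (auto simp: clinear_map_def R_def fun_eq_iff)
  have L_eq: "L f = (\<lambda>i. f (Inl i)) - s (R f)" for f by (simp add: L_def R_def)
  have L: "clinear_map L"
    unfolding clinear_map_def L_eq
    by (auto simp: clinear_map_add[OF s] clinear_map_csc[OF s] clinear_map_add[OF R]
        clinear_map_csc[OF R] fun_eq_iff algebra_simps)
  have I: "clinear_map I"
    by (auto simp: clinear_map_def I_def fun_eq_iff split: sum.split)
  define D where "D = (\<lambda>f g. B (L f) (L g) + \<kappa> (R f) (R g))"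
  have D: "psd_form D" unfolding D_def
    by (rule psd_form_add[OF psd_form_comp[OF B L] psd_form_comp[OF \<kappa> R]])
  obtain D' where D': "psd_form D'"
    and min: "\<forall>v. (\<forall>w. (\<forall>i. i \<notin> range Inr \<longrightarrow> w i = 0) \<longrightarrow> Re (D' v v) \<le> Re (D (v + w) (v + w))) \<and>
      (\<exists>w. (\<forall>i. i \<notin> range Inr \<longrightarrow> w i = 0) \<and> Re (D' v v) = Re (D (v + w) (v + w)))"
    using psd_form_eliminate_coordinates[OF finite_imageI[OF finite_class.finite_UNIV] D, of Inr]
    by (elim exE conjE)
  have le: "Re (D' v v) \<le> Re (D (v + w) (v + w))" if "\<And>i. i \<notin> range Inr \<Longrightarrow> w i = 0" for v w
    using min that by simp
  have ex: "\<exists>w. (\<forall>i. i \<notin> range Inr \<longrightarrow> w i = 0) \<and> Re (D' v v) = Re (D (v + w) (v + w))" for v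
    using min by simp
  have val: "D (I z + w) (I z + w) = B (z - s (R w)) (z - s (R w)) + \<kappa> (R w) (R w)"
    if "\<And>i. i \<notin> range Inr \<Longrightarrow> w i = 0" for z w
  proof -
    have 1: "R (I z + w) = R w" by (auto simp: R_def I_def fun_eq_iff)
    have "w (Inl i) = 0" for i using that by auto
    then have 2: "L (I z + w) = z - s (R w)"
      unfolding L_eq 1 by (auto simp: I_def fun_eq_iff)
    show ?thesis by (simp add: D_def 1 2)
  qed
  show ?thesis
  proof
    show "psd_form (\<lambda>u v. D' (I u) (I v))" by (rule psd_form_comp[OF D' I])
    show "Re (D' (I z) (I z)) \<le> Re (B (z - s w) (z - s w)) + Re (\<kappa> w w)" for z w
    proof -
      define w' where "w' = (\<lambda>k::'i + 'j. case k of Inl i \<Rightarrow> 0 | Inr j \<Rightarrow> w j)"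
      have z': "w' i = 0" if "i \<notin> range Inr" for i
        using that by (auto simp: w'_def split: sum.split)
      have "R w' = w" by (simp add: R_def w'_def)
      then show ?thesis using le[of w' "I z", OF z'] val[of w' z, OF z'] by simp
    qed
    show "\<exists>w. Re (D' (I z) (I z)) = Re (B (z - s w) (z - s w)) + Re (\<kappa> w w)" for z
    proof -
      obtain w where w: "\<forall>i. i \<notin> range Inr \<longrightarrow> w i = 0"
        and eq: "Re (D' (I z) (I z)) = Re (D (I z + w) (I z + w))"
        using ex[of "I z"] by (elim exE conjE)
      have "D (I z + w) (I z + w) = B (z - s (R w)) (z - s (R w)) + \<kappa> (R w) (R w)"
        by (rule val) (use w in simp)
      then show ?thesis using eq by (intro exI[of _ "R w"]) simp
    qed
  qed
qed

section \<open>Effects and sequential decoding\<close>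

text \<open>The index set \<open>S\<close> is explicit because tilt directions are indexed by an
  infinite type of which only finitely many members are in use. On the whole type the form is
  degenerate in the coordinates outside \<open>S\<close>.\<close>

definition ip :: "'i set \<Rightarrow> ('i \<Rightarrow> complex) \<Rightarrow> ('i \<Rightarrow> complex) \<Rightarrow> complex" where
  "ip S u v = (\<Sum>i\<in>S. cnj (u i) * v i)"

lemma psd_form_ip: "psd_form (ip S)"
proof
  show "0 \<le> Re (ip S v v)" for v
    unfolding ip_def Re_sum by (rule sum_nonneg) simp
qed (simp_all add: ip_def sum.distrib algebra_simps sum_distrib_left)

interpretation ip: psd_form "ip S" for S
  by (rule psd_form_ip)

lemma ip_mono: "finite S' \<Longrightarrow> S \<subseteq> S' \<Longrightarrow> Re (ip S v v) \<le> Re (ip S' v v)"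
  unfolding ip_def Re_sum by (rule sum_mono2) auto

text \<open>An operator between 0 and the identity for the inner product on \<open>S\<close>, that
  is, a POVM element acting on vectors.\<close>

definition effect :: "'i set \<Rightarrow> (('i \<Rightarrow> complex) \<Rightarrow> 'i \<Rightarrow> complex) \<Rightarrow> bool" where
  "effect S F \<longleftrightarrow> clinear_map F \<and> psd_form (\<lambda>u v. ip S u (F v)) \<and>
     (\<forall>v. Re (ip S v (F v)) \<le> Re (ip S v v))"

lemma effect_clinear: "effect S F \<Longrightarrow> clinear_map F"
  and effect_form: "effect S F \<Longrightarrow> psd_form (\<lambda>u v. ip S u (F v))"
  and effect_le: "effect S F \<Longrightarrow> Re (ip S v (F v)) \<le> Re (ip S v v)"
  by (auto simp: effect_def)

lemma effect_selfadjoint: "effect S F \<Longrightarrow> ip S (F u) v = ip S u (F v)"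
  using psd_form.herm[OF effect_form, of S F v u] ip.herm[of S v "F u"] by simp

lemma effect_nonneg: "effect S F \<Longrightarrow> 0 \<le> Re (ip S v (F v))"
  by (rule psd_form.nonneg[OF effect_form])

text \<open>Cauchy-Schwarz for the form of \<open>F\<close>, applied to \<open>v\<close> and
  \<open>F v\<close>, together with \<open>F \<le> 1\<close>; no square root of \<open>F\<close>
  enters.\<close>

lemma effect_square_le:
  assumes "effect S F"
  shows "Re (ip S (F v) (F v)) \<le> Re (ip S v (F v))"
proof -
  define a where "a = Re (ip S (F v) (F v))"
  have a0: "a \<ge> 0" by (simp add: a_def ip.nonneg)
  have "ip S v (F (F v)) = of_real a"
    using effect_selfadjoint[OF assms, of v "F v"] ip.diag_real[of S "F v"] by (simp add: a_def)
  then have "a\<^sup>2 = (cmod (ip S v (F (F v))))\<^sup>2" by simp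
  also have "\<dots> \<le> Re (ip S v (F v)) * Re (ip S (F v) (F (F v)))"
    by (rule psd_form.cauchy_schwarz[OF effect_form[OF assms]])
  also have "\<dots> \<le> Re (ip S v (F v)) * a"
    unfolding a_def by (rule mult_left_mono[OF effect_le[OF assms] effect_nonneg[OF assms]])
  finally have "a * a \<le> Re (ip S v (F v)) * a" by (simp add: power2_eq_square)
  then show ?thesis using a0 effect_nonneg[OF assms, of v]
    by (cases "a = 0") (simp_all add: a_def)
qed

lemma effect_compl:
  assumes "effect S F"
  shows "effect S (\<lambda>v. v - F v)"
  unfolding effect_def
proof (intro conjI allI)
  show "clinear_map (\<lambda>v. v - F v)" by (rule clinear_map_compl[OF effect_clinear[OF assms]])
  show "psd_form (\<lambda>u v. ip S u (v - F v))"
    unfolding ip.diff_right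
    by (rule psd_form_diff[OF psd_form_ip effect_form[OF assms] effect_le[OF assms]])
  show "Re (ip S v (v - F v)) \<le> Re (ip S v v)" for v
    using effect_nonneg[OF assms] by (simp add: ip.diff_right)
qed

text \<open>The representing operator is found by pairing \<open>B\<close> with the basis vectors.
  Domination by \<open>ip S\<close> makes \<open>B\<close> vanish on vectors that are zero on
  \<open>S\<close>, so that the coordinates in \<open>S\<close> determine it.\<close>

lemma psd_form_to_effect:
  assumes B: "psd_form B" and S: "finite S" and le: "\<And>v. Re (B v v) \<le> Re (ip S v v)"
  obtains F where "effect S F" "\<And>u v. ip S u (F v) = B u v"
proof -
  interpret B: psd_form B by fact
  define F where "F = (\<lambda>v i. B (unitvec i) v)"
  have eq: "ip S u (F v) = B u v" for u v
  proof -
    define u' where "u' = (\<lambda>i. \<Sum>k\<in>S. csc (u k) (unitvec k) i)"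
    have u': "u' i = (if i \<in> S then u i else 0)" for i
      using S by (simp add: u'_def unitvec_def if_distrib[of "\<lambda>x. _ * x"] sum.delta cong: if_cong)
    have "ip S (u - u') (u - u') = 0"
      by (simp add: ip_def u')
    then have "Re (B (u - u') (u - u')) = 0"
      using le[of "u - u'"] B.nonneg[of "u - u'"] by simp
    then have "B u v = B u' v"
      using B.null_left[of "u - u'" v] by (simp add: B.diff_left)
    also have "\<dots> = (\<Sum>k\<in>S. B (csc (u k) (unitvec k)) v)"
      unfolding u'_def by (rule B.sum_left[OF S])
    finally show ?thesis by (simp add: ip_def F_def B.csc_left)
  qed
  have "clinear_map F"
    by (auto simp: clinear_map_def F_def fun_eq_iff B.sesq)
  then have "effect S F" using B le by (simp add: effect_def eq)
  then show ?thesis using that eq by blast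
qed

text \<open>The unnormalised state left when tests \<open>0\<close> to \<open>k - 1\<close> have all
  answered no. The measurement operators are \<open>Q\<close> and \<open>1 - Q\<close> themselves;
  since \<open>Q\<close> is an effect, their squares sum to at most the identity, with equality for
  projections.\<close>

primrec survive :: "(nat \<Rightarrow> ('i \<Rightarrow> complex) \<Rightarrow> 'i \<Rightarrow> complex) \<Rightarrow> nat \<Rightarrow> ('i \<Rightarrow> complex) \<Rightarrow> 'i \<Rightarrow> complex" where
  "survive Q 0 v = v"
| "survive Q (Suc k) v = survive Q k v - Q k (survive Q k v)"

lemma survive_cong: "(\<And>j. j < k \<Longrightarrow> Q j = Q' j) \<Longrightarrow> survive Q k v = survive Q' k v"
  by (induction k) auto

lemma clinear_survive:
  "(\<And>j. j < k \<Longrightarrow> clinear_map (Q j)) \<Longrightarrow> clinear_map (survive Q k)"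
proof (induction k)
  case 0
  then show ?case by (simp add: clinear_map_def)
next
  case (Suc k)
  then have Q: "clinear_map (Q k)" and s: "clinear_map (survive Q k)" by auto
  have "clinear_map (\<lambda>v. survive Q k v - Q k (survive Q k v))"
    by (rule clinear_map_comp[OF clinear_map_compl[OF Q] s])
  moreover have "survive Q (Suc k) = (\<lambda>v. survive Q k v - Q k (survive Q k v))"
    by (rule ext) (rule survive.simps(2))
  ultimately show ?case by (simp only:)
qed

text \<open>The non-commutative union bound: telescoping \<open>\<langle>v, v - v\<^sub>n\<rangle>\<close> over the successive residual
  vectors and applying the weighted Cauchy-Schwarz inequality to each summand.\<close>

lemma union_bound:
  assumes "\<And>k. k < n \<Longrightarrow> effect S (Q k)"
  shows "Re (ip S v v) - Re (ip S (survive Q n v) (survive Q n v))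
    \<le> 4 * (\<Sum>k<n. Re (ip S v (Q k v)))"
proof -
  define u where "u = (\<lambda>k. survive Q k v)"
  define q where "q = (\<lambda>k. Re (ip S (u k) (Q k (u k))))"
  \<comment> \<open>One step lowers the squared norm by \<open>2 q\<close> minus the squared norm of
    \<open>Q u\<close>, hence by at least \<open>q\<close>.\<close>
  have drop: "(\<Sum>k<m. q k) \<le> Re (ip S v v) - Re (ip S (u m) (u m))" if "m \<le> n" for m
    using that
  proof (induction m)
    case 0
    then show ?case by (simp add: u_def)
  next
    case (Suc m)
    have e: "effect S (Q m)" using Suc assms by simp
    have "Re (ip S (u (Suc m)) (u (Suc m)))
        = Re (ip S (u m) (u m)) - 2 * q m + Re (ip S (Q m (u m)) (Q m (u m)))"
      by (simp add: u_def q_def ip.sesq effect_selfadjoint[OF e])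
    then show ?case using effect_square_le[OF e, of "u m"] Suc by (simp add: q_def)
  qed
  have tele: "Re (ip S v v) - Re (ip S v (u m)) \<le> (\<Sum>k<m. Re (ip S v (Q k v))) + (\<Sum>k<m. q k) / 4"
    if "m \<le> n" for m
    using that
  proof (induction m)
    case 0
    then show ?case by (simp add: u_def)
  next
    case (Suc m)
    have e: "effect S (Q m)" using Suc assms by simp
    \<comment> \<open>Weight 1/2 leaves the summand of the claim with coefficient 1 and puts only
      1/4 on \<open>q m\<close>, which the loss of norm pays for.\<close>
    have "2 * Re (ip S v (Q m (u m))) \<le> (1/2) * Re (ip S (u m) (Q m (u m))) + Re (ip S v (Q m v)) / (1/2)"
      by (rule psd_form.Re_le_weighted[OF effect_form[OF e]]) simp
    moreover have "ip S v (u (Suc m)) = ip S v (u m) - ip S v (Q m (u m))"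
      by (simp add: u_def ip.sesq)
    ultimately show ?case using Suc by (simp add: q_def add_divide_distrib)
  qed
  \<comment> \<open>This turns the overlap in \<open>tele\<close> into half of the norm loss; a
    quarter of the norm loss is spent on the \<open>q k\<close>, and the remaining quarter gives the
    factor 4.\<close>
  have "2 * Re (ip S v (u n)) \<le> 1 * Re (ip S (u n) (u n)) + Re (ip S v v) / 1"
    by (rule ip.Re_le_weighted) simp
  then show ?thesis using drop[of n] tele[of n] by (simp add: u_def)
qed

text \<open>The tests are applied in order and the first one that accepts names the outcome. Outcome
  \<open>k\<close> is correct when tests \<open>0\<close> to \<open>k - 1\<close> reject and test
  \<open>k\<close> accepts, which is a run of the union bound with \<open>1 - E k\<close> as its
  last test.\<close>

lemma sequential_decoder:
  fixes E :: "nat \<Rightarrow> ('i \<Rightarrow> complex) \<Rightarrow> 'i \<Rightarrow> complex"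
  assumes E: "\<And>k. k < n \<Longrightarrow> effect S (E k)" and n: "n > 0"
  obtains L where "\<And>k. k < n \<Longrightarrow> psd_form (L k)"
    "\<And>u v. (\<Sum>k<n. L k u v) = ip S u v"
    "\<And>k v. k < n \<Longrightarrow> Re (ip S v v) - Re (L k v v)
       \<le> 4 * (Re (ip S v v) - Re (ip S v (E k v)) + (\<Sum>j<k. Re (ip S v (E j v))))"
proof -
  define K where "K = (\<lambda>k v. E k (survive E k v))"
  have lin: "clinear_map (K k)" if "k < n" for k
  proof -
    have "clinear_map (survive E k)" using that by (intro clinear_survive effect_clinear[OF E]) simp
    then show ?thesis using effect_clinear[OF E[OF that]] by (simp add: clinear_map_def K_def)
  qed
  define N where "N = (\<lambda>k u v. ip S (K k u) (K k v))"
  have N: "psd_form (N k)" if "k < n" for k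
    unfolding N_def by (rule psd_form_comp[OF psd_form_ip lin[OF that]])
  have sub: "(\<Sum>k<m. Re (N k v v)) + Re (ip S (survive E m v) (survive E m v)) \<le> Re (ip S v v)"
    if "m \<le> n" for m v
    using that
  proof (induction m)
    case 0
    then show ?case by simp
  next
    case (Suc m)
    have e: "effect S (E m)" using Suc E by simp
    define u where "u = survive E m v"
    have "Re (ip S (u - E m u) (u - E m u)) + Re (ip S (E m u) (E m u)) \<le> Re (ip S u u)"
      using effect_square_le[OF e, of u] by (simp add: ip.sesq effect_selfadjoint[OF e])
    moreover have "survive E (Suc m) v = u - E m u" by (simp only: survive.simps u_def)
    moreover have "N m v v = ip S (E m u) (E m u)" by (simp add: N_def K_def u_def)
    ultimately show ?case
      using Suc unfolding u_def[symmetric] sum.lessThan_Suc by (simp only:) linarith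
  qed
  define D where "D = (\<lambda>u v. ip S u v - (\<Sum>k<n. N k u v))"
  have D: "psd_form D"
    unfolding D_def
  proof (rule psd_form_diff[OF psd_form_ip psd_form_sum])
    show "Re (\<Sum>k<n. N k v v) \<le> Re (ip S v v)" for v
      using sub[of n v] ip.nonneg[of S "survive E n v"] by simp
  qed (use N in simp)
  define L where "L = (\<lambda>k u v. N k u v + (if k = 0 then D u v else 0))"
  have L_ge: "Re (N k v v) \<le> Re (L k v v)" for k v
    using psd_form.nonneg[OF D, of v] by (simp add: L_def)
  show ?thesis
  proof
    show "psd_form (L k)" if "k < n" for k
    proof (cases "k = 0")
      case True
      then show ?thesis using psd_form_add[OF N[OF that] D] by (simp add: L_def)
    next
      case False
      then show ?thesis using N[OF that] by (simp add: L_def)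
    qed
    show "(\<Sum>k<n. L k u v) = ip S u v" for u v
      using n by (simp add: L_def sum.distrib D_def)
    fix k v assume k: "k < n"
    \<comment> \<open>Rejecting with \<open>1 - E k\<close> leaves \<open>E k\<close> applied to the
      residual vector, which is \<open>K k v\<close>.\<close>
    define Q where "Q = (\<lambda>j. if j = k then (\<lambda>v. v - E k v) else E j)"
    have Q: "effect S (Q j)" if "j < Suc k" for j
      using that k E effect_compl by (auto simp: Q_def)
    have "survive Q (Suc k) v = K k v"
      using survive_cong[of k Q E v] by (simp add: Q_def K_def)
    then have "Re (ip S v v) - Re (N k v v) \<le> 4 * (\<Sum>j<Suc k. Re (ip S v (Q j v)))"
      using union_bound[of "Suc k" S Q v] Q by (simp only: N_def)
    also have "(\<Sum>j<Suc k. Re (ip S v (Q j v)))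
        = Re (ip S v v) - Re (ip S v (E k v)) + (\<Sum>j<k. Re (ip S v (E j v)))"
      by (simp add: Q_def ip.sesq)
    finally show "Re (ip S v v) - Re (L k v v)
       \<le> 4 * (Re (ip S v v) - Re (ip S v (E k v)) + (\<Sum>j<k. Re (ip S v (E j v))))"
      using L_ge[of k v] by simp
  qed
qed

text \<open>The tests are run along some enumeration of \<open>I\<close>. Extending the sum from the
  earlier competitors to all of them makes the bound independent of the order.\<close>

lemma sequential_decoder_set:
  assumes E: "\<And>k. k \<in> I \<Longrightarrow> effect S (E k)" and I: "finite I" "I \<noteq> {}"
  obtains L where "\<And>k. k \<in> I \<Longrightarrow> psd_form (L k)"
    "\<And>u v. (\<Sum>k\<in>I. L k u v) = ip S u v"
    "\<And>k v. k \<in> I \<Longrightarrow> Re (ip S v v) - Re (L k v v)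
       \<le> 4 * (Re (ip S v v) - Re (ip S v (E k v)) + (\<Sum>j\<in>I - {k}. Re (ip S v (E j v))))"
proof -
  define n where "n = card I"
  obtain h where h: "bij_betw h {..<n} I"
    using ex_bij_betw_nat_finite[OF I(1)] by (auto simp: n_def lessThan_atLeast0)
  have n: "n > 0" using I by (simp add: n_def card_gt_0_iff)
  have hI: "h k \<in> I" if "k < n" for k using h that by (auto simp: bij_betw_def)
  define g where "g = inv_into {..<n} h"
  have g: "g (h k) = k" if "k < n" for k
    using h that by (simp add: g_def bij_betw_inv_into_left)
  have gI: "g i < n" "h (g i) = i" if "i \<in> I" for i
    using bij_betwE[OF bij_betw_inv_into[OF h]] bij_betw_inv_into_right[OF h] that
    by (auto simp: g_def)
  obtain L where L: "\<And>k. k < n \<Longrightarrow> psd_form (L k)"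
    and tot: "\<And>u v. (\<Sum>k<n. L k u v) = ip S u v"
    and err: "\<And>k v. k < n \<Longrightarrow> Re (ip S v v) - Re (L k v v)
       \<le> 4 * (Re (ip S v v) - Re (ip S v (E (h k) v)) + (\<Sum>j<k. Re (ip S v (E (h j) v))))"
    using sequential_decoder[of n S "\<lambda>k. E (h k)", OF E[OF hI] n] by blast
  show ?thesis
  proof (rule that[of "\<lambda>i. L (g i)"])
    show "psd_form (L (g i))" if "i \<in> I" for i using L gI that by simp
    show "(\<Sum>i\<in>I. L (g i) u v) = ip S u v" for u v
      using sum.reindex_bij_betw[OF h, of "\<lambda>i. L (g i) u v"] g tot[of u v] by simp
    fix i v assume i: "i \<in> I"
    have inj: "inj_on h {..<g i}" using h gI[OF i]
      by (auto simp: bij_betw_def intro: inj_on_subset)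
    have "(\<Sum>j<g i. Re (ip S v (E (h j) v))) = (\<Sum>j\<in>h ` {..<g i}. Re (ip S v (E j v)))"
      by (simp add: sum.reindex[OF inj])
    also have "\<dots> \<le> (\<Sum>j\<in>I - {i}. Re (ip S v (E j v)))"
    proof (rule sum_mono2)
      show "h ` {..<g i} \<subseteq> I - {i}"
      proof (intro subsetI DiffI; elim imageE; simp)
        fix j assume "j < g i"
        then have "j < n" "j \<noteq> g i" using gI[OF i] by auto
        then show "h j \<in> I" "h j \<noteq> i" using hI g by auto
      qed
    qed (use I E effect_nonneg in auto)
    finally show "Re (ip S v v) - Re (L (g i) v v)
       \<le> 4 * (Re (ip S v v) - Re (ip S v (E i v)) + (\<Sum>j\<in>I - {i}. Re (ip S v (E j v))))"
      using err[of "g i" v] gI[OF i] by simp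
  qed
qed

section \<open>The tilted joint test\<close>

definition tvec :: "('i \<Rightarrow> complex) \<Rightarrow> ('d \<Rightarrow> complex) \<Rightarrow> 'i \<times> 'd \<Rightarrow> complex" where
  "tvec v c = (\<lambda>(i, d). v i * c d)"

lemma ip_tvec: "ip (A \<times> D) (tvec u b) (tvec v c) = ip A u v * ip D b c"
  by (simp add: ip_def tvec_def sum_product sum.cartesian_product mult_ac split_def)

lemma clinear_tvec: "clinear_map (\<lambda>v. tvec v c)"
  by (auto simp: clinear_map_def tvec_def fun_eq_iff algebra_simps)

lemma tvec_diff_right: "tvec u (b - c) = tvec u b - tvec u c"
  by (auto simp: tvec_def fun_eq_iff algebra_simps)

lemma ip_cong: "(\<And>i. i \<in> S \<Longrightarrow> u i = u' i) \<Longrightarrow> (\<And>i. i \<in> S \<Longrightarrow> v i = v' i) \<Longrightarrow> ip S u v = ip S u' v'"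
  by (simp add: ip_def)

text \<open>\<open>T\<close> minus its square measures how far a test is from being projective. It
  serves as the penalty that lets non-projective tests enter the infimal convolution.\<close>

lemma effect_defect_form:
  assumes "effect S T"
  shows "psd_form (\<lambda>u v. ip S u (T v) - ip S (T u) (T v))"
  by (rule psd_form_diff[OF effect_form[OF assms]
        psd_form_comp[OF psd_form_ip effect_clinear[OF assms]] effect_square_le[OF assms]])

text \<open>Weighted Cauchy-Schwarz for the form of \<open>1 - T\<close>, where the value of that
  form at \<open>w\<close> splits into the squared norm of the rejected vector
  \<open>w - T w\<close> and the defect of \<open>T\<close> at \<open>w\<close>.\<close>

lemma effect_compl_weighted:
  assumes "effect S T" "t > 0"
  shows "2 * Re (ip S v (w - T w)) \<le>
    t * (Re (ip S (w - T w) (w - T w)) + (Re (ip S w (T w)) - Re (ip S (T w) (T w))))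
      + (Re (ip S v v) - Re (ip S v (T v))) / t"
proof -
  have 1: "2 * Re (ip S v (w - T w)) \<le> t * Re (ip S w (w - T w)) + Re (ip S v (v - T v)) / t"
    by (rule psd_form.Re_le_weighted[OF effect_form[OF effect_compl[OF assms(1)]] assms(2)])
  have 2: "Re (ip S w (w - T w))
      = Re (ip S (w - T w) (w - T w)) + (Re (ip S w (T w)) - Re (ip S (T w) (T w)))"
    by (simp add: ip.sesq effect_selfadjoint[OF assms(1)])
  have 3: "Re (ip S v (v - T v)) = Re (ip S v v) - Re (ip S v (T v))"
    by (simp add: ip.diff_right)
  show ?thesis using 1 unfolding 2 3 .
qed

text \<open>Here \<open>x\<close>, \<open>y\<close>, \<open>z\<close> are the rejected vectors of
  three tests, the \<open>k\<close> are their defects and the \<open>w\<close> the rejection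
  probabilities of \<open>v\<close>. Without tilt only the norm of \<open>x + y + z\<close> would be
  available, which does not control the summands; the extra terms \<open>e |y|^2 + e |z|^2\<close>
  restore that control, at the price of a factor of order \<open>1 / e\<close> on the rejection
  probabilities.\<close>

lemma tilted_gap:
  fixes x y z v :: "'z \<Rightarrow> complex" and e :: real
  assumes e: "0 < e" "e \<le> 1" and k: "k1 \<ge> 0" "k2 \<ge> 0" "k3 \<ge> 0"
    and x: "2 * Re (ip S v x) \<le> e / 6 * (Re (ip S x x) + k3) + w3 / (e / 6)"
    and y: "2 * Re (ip S v y) \<le> e / (2 * (1 + e)) * (Re (ip S y y) + k1) + w1 / (e / (2 * (1 + e)))"
    and z: "2 * Re (ip S v z) \<le> e / (2 * (1 + e)) * (Re (ip S z z) + k2) + w2 / (e / (2 * (1 + e)))"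
  shows "2 * Re (ip S v x) + 2 * (1 + e) * Re (ip S v y) + 2 * (1 + e) * Re (ip S v z)
    \<le> Re (ip S (x + y + z) (x + y + z)) + e * Re (ip S y y) + e * Re (ip S z z)
      + (1 + e) * (k1 + k2 + k3) + 6 / e * w3 + 2 * (1 + e)\<^sup>2 / e * (w1 + w2)"
proof -
  define p where "p = x + y + z"
  define nx ny nz np where n: "nx = Re (ip S x x)" "ny = Re (ip S y y)" "nz = Re (ip S z z)" "np = Re (ip S p p)"
  \<comment> \<open>This is the estimate of \<open>x = p - y - z\<close> by three times the sum of
    squared norms, in the form of an explicit sum of squares.\<close>
  have "0 \<le> Re (ip S (p + y) (p + y)) + Re (ip S (p + z) (p + z)) + Re (ip S (y - z) (y - z))"
    by (simp add: ip.nonneg)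
  also have "\<dots> = 3 * (np + ny + nz) - nx"
    using ip.Re_sym[of S x y] ip.Re_sym[of S x z] ip.Re_sym[of S y z]
    unfolding n p_def ip.sesq by simp
  finally have "nx \<le> 3 * (np + ny + nz)" by simp
  then have "e / 6 * nx \<le> e / 6 * (3 * (np + ny + nz))" using e by (intro mult_left_mono) auto
  then have nx: "e / 6 * nx \<le> e / 2 * np + e / 2 * ny + e / 2 * nz" by (simp add: algebra_simps)
  have np: "e / 2 * np \<le> np" using e ip.nonneg[of S p] mult_right_mono[of "e / 2" 1 np]
    by (simp add: n)
  have k': "e / 2 * k1 \<le> (1 + e) * k1" "e / 2 * k2 \<le> (1 + e) * k2" "e / 6 * k3 \<le> (1 + e) * k3"
    by (rule mult_right_mono; use e k in simp)+
  \<comment> \<open>The weights split the available \<open>e |y|^2\<close> and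
    \<open>e |z|^2\<close> evenly: one half pays for \<open>x\<close>, the other for the vector's
    own cross term.\<close>
  have scale: "c * (e / (2 * c) * A + w / (e / (2 * c))) = e / 2 * A + 2 * c\<^sup>2 / e * w"
    if "c \<noteq> 0" for c A w :: real
    using e that by (simp add: field_simps power2_eq_square)
  have y': "2 * (1 + e) * Re (ip S v y) \<le> e / 2 * (ny + k1) + 2 * (1 + e)\<^sup>2 / e * w1"
  proof -
    have "2 * (1 + e) * Re (ip S v y) \<le> (1 + e) * (e / (2 * (1 + e)) * (ny + k1) + w1 / (e / (2 * (1 + e))))"
      using mult_left_mono[OF y, of "1 + e"] e unfolding n by (simp only: mult_ac)
    also have "\<dots> = e / 2 * (ny + k1) + 2 * (1 + e)\<^sup>2 / e * w1"
      by (rule scale) (use e in simp)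
    finally show ?thesis .
  qed
  have z': "2 * (1 + e) * Re (ip S v z) \<le> e / 2 * (nz + k2) + 2 * (1 + e)\<^sup>2 / e * w2"
  proof -
    have "2 * (1 + e) * Re (ip S v z) \<le> (1 + e) * (e / (2 * (1 + e)) * (nz + k2) + w2 / (e / (2 * (1 + e))))"
      using mult_left_mono[OF z, of "1 + e"] e unfolding n by (simp only: mult_ac)
    also have "\<dots> = e / 2 * (nz + k2) + 2 * (1 + e)\<^sup>2 / e * w2"
      by (rule scale) (use e in simp)
    finally show ?thesis .
  qed
  have x': "2 * Re (ip S v x) \<le> e / 6 * nx + e / 6 * k3 + 6 / e * w3"
    using x by (simp add: n algebra_simps)
  have d: "e / 2 * (ny + k1) = e / 2 * ny + e / 2 * k1" "e / 2 * (nz + k2) = e / 2 * nz + e / 2 * k2"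
    "(1 + e) * (k1 + k2 + k3) = (1 + e) * k1 + (1 + e) * k2 + (1 + e) * k3"
    "2 * (1 + e)\<^sup>2 / e * (w1 + w2) = 2 * (1 + e)\<^sup>2 / e * w1 + 2 * (1 + e)\<^sup>2 / e * w2"
    by (simp_all add: distrib_left)
  have s: "e * ny = e / 2 * ny + e / 2 * ny" "e * nz = e / 2 * nz + e / 2 * nz" by simp_all
  show ?thesis
    using nx np k' y' z' x' unfolding d n(2,3)[symmetric] s p_def[symmetric] n(4)[symmetric]
    by linarith
qed

text \<open>The test is the infimal convolution of the squared norm with the three rejection forms, where
  the rejected vectors of the tests \<^term>\<open>T1\<close> and \<^term>\<open>T2\<close> are tilted in the directions \<^term>\<open>b\<close>
  and \<^term>\<open>a\<close>.  For projective tests it is the projection onto the orthogonal complement of the sum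
  of the three tilted rejection subspaces.\<close>

lemma joint_test:
  fixes T1 T2 T3 :: "('z::finite \<Rightarrow> complex) \<Rightarrow> 'z \<Rightarrow> complex" and \<delta> :: real and r a b :: 'd
  assumes T1: "effect UNIV T1" and T2: "effect UNIV T2" and T3: "effect UNIV T3"
    and \<delta>: "0 < \<delta>" "\<delta> \<le> 1" and dist: "r \<noteq> a" "r \<noteq> b" "a \<noteq> b"
  obtains P where "psd_form P"
    "\<And>z. Re (P z z) \<le> Re (ip (UNIV \<times> {r, a, b}) z z)"
    "\<And>v c. c r = 1 \<Longrightarrow> c a = 0 \<Longrightarrow> c b = of_real \<delta> \<Longrightarrow>
       Re (P (tvec v c) (tvec v c)) \<le> (1 + \<delta>\<^sup>2) * Re (ip UNIV v (T1 v))"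
    "\<And>v c. c r = 1 \<Longrightarrow> c a = of_real \<delta> \<Longrightarrow> c b = 0 \<Longrightarrow>
       Re (P (tvec v c) (tvec v c)) \<le> (1 + \<delta>\<^sup>2) * Re (ip UNIV v (T2 v))"
    "\<And>v c. c r = 1 \<Longrightarrow> c a = 0 \<Longrightarrow> c b = 0 \<Longrightarrow>
       Re (P (tvec v c) (tvec v c)) \<le> (1 + \<delta>\<^sup>2) * Re (ip UNIV v (T3 v))"
    "\<And>v c. c r = 1 \<Longrightarrow> c a = of_real \<delta> \<Longrightarrow> c b = of_real \<delta> \<Longrightarrow>
       (1 + 2 * \<delta>\<^sup>2) * Re (ip UNIV v v) - Re (P (tvec v c) (tvec v c))
       \<le> 6 / \<delta>\<^sup>2 * (Re (ip UNIV v v) - Re (ip UNIV v (T3 v)))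
        + 2 * (1 + \<delta>\<^sup>2)\<^sup>2 / \<delta>\<^sup>2 * ((Re (ip UNIV v v) - Re (ip UNIV v (T1 v)))
            + (Re (ip UNIV v v) - Re (ip UNIV v (T2 v))))"
proof -
  define e where "e = \<delta>\<^sup>2"
  have e: "0 < e" "e \<le> 1" using \<delta> by (auto simp: e_def power_le_one)
  have \<delta>\<delta>: "complex_of_real \<delta> * complex_of_real \<delta> = of_real e"
    by (simp add: e_def power2_eq_square)
  define D where "D = {r, a, b}"
  \<comment> \<open>\<open>r\<close> is the untilted direction. The rejection vectors of the first
    test are tilted along \<open>b\<close>, those of the second along \<open>a\<close>, those of the
    third not at all.\<close>
  define f3 where "f3 = (\<lambda>d. if d = r then 1 else 0 :: complex)"
  define f1 where "f1 = (\<lambda>d. if d = r then 1 else if d = b then of_real \<delta> else 0 :: complex)"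
  define f2 where "f2 = (\<lambda>d. if d = r then 1 else if d = a then of_real \<delta> else 0 :: complex)"
  define s1 s2 s3 where s: "s1 = (\<lambda>w. tvec (w - T1 w) f1)" "s2 = (\<lambda>w. tvec (w - T2 w) f2)"
    "s3 = (\<lambda>w. tvec (w - T3 w) f3)"
  have lin: "clinear_map s1" "clinear_map s2" "clinear_map s3"
    unfolding s by (rule clinear_map_comp[OF clinear_tvec
          clinear_map_compl[OF effect_clinear[OF T1]]]
        clinear_map_comp[OF clinear_tvec clinear_map_compl[OF effect_clinear[OF T2]]]
        clinear_map_comp[OF clinear_tvec clinear_map_compl[OF effect_clinear[OF T3]]])+
  \<comment> \<open>The factor \<open>1 + e\<close> is the largest squared norm of the three tilt
    vectors; with it the accepted part and the penalty add up to at most \<open>1 + e\<close> times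
    the acceptance probability.\<close>
  define k where "k = (\<lambda>T (u::'z \<Rightarrow> complex) v. complex_of_real (1 + e) * (ip UNIV u (T v) - ip UNIV (T u) (T v)))"
  have k: "psd_form (k T1)" "psd_form (k T2)" "psd_form (k T3)"
    unfolding k_def
    by (rule psd_form_scale[OF effect_defect_form[OF T1]] psd_form_scale[OF effect_defect_form[OF T2]]
        psd_form_scale[OF effect_defect_form[OF T3]]; use e in simp)+
  have k0: "Re (k T w w) = (1 + e) * (Re (ip UNIV w (T w)) - Re (ip UNIV (T w) (T w)))" for T w
    by (simp add: k_def)
  have s0: "s1 0 = 0" "s2 0 = 0" "s3 0 = 0" by (rule clinear_map_zero, rule lin)+
  have kz: "k T1 0 0 = 0" "k T2 0 0 = 0" "k T3 0 0 = 0" using k psd_form.zero_left by blast+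
  define H where "H = ip ((UNIV :: 'z set) \<times> D)"
  have H: "psd_form H" unfolding H_def by (rule psd_form_ip)
  obtain P1 where P1: "psd_form P1"
    and le1: "\<And>z w. Re (P1 z z) \<le> Re (H (z - s1 w) (z - s1 w)) + Re (k T1 w w)"
    and ex1: "\<And>z. \<exists>w. Re (P1 z z) = Re (H (z - s1 w) (z - s1 w)) + Re (k T1 w w)"
    using psd_form_inf_convolution[OF H k(1) lin(1)] by metis
  obtain P2 where P2: "psd_form P2"
    and le2: "\<And>z w. Re (P2 z z) \<le> Re (P1 (z - s2 w) (z - s2 w)) + Re (k T2 w w)"
    and ex2: "\<And>z. \<exists>w. Re (P2 z z) = Re (P1 (z - s2 w) (z - s2 w)) + Re (k T2 w w)"
    using psd_form_inf_convolution[OF P1 k(2) lin(2)] by metis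
  obtain P where P: "psd_form P"
    and le3: "\<And>z w. Re (P z z) \<le> Re (P2 (z - s3 w) (z - s3 w)) + Re (k T3 w w)"
    and ex3: "\<And>z. \<exists>w. Re (P z z) = Re (P2 (z - s3 w) (z - s3 w)) + Re (k T3 w w)"
    using psd_form_inf_convolution[OF P2 k(3) lin(3)] by metis
  have l32: "Re (P z z) \<le> Re (P2 z z)" for z using le3[of z 0] by (simp add: s0 kz)
  have l21: "Re (P2 z z) \<le> Re (P1 z z)" for z using le2[of z 0] by (simp add: s0 kz)
  have l1: "Re (P1 z z) \<le> Re (H z z)" for z using le1[of z 0] by (simp add: s0 kz)
  have ipf: "ip D f1 f1 = of_real (1 + e)" "ip D f2 f2 = of_real (1 + e)" "ip D f3 f3 = 1"
    "ip D f1 f2 = 1" "ip D f1 f3 = 1" "ip D f2 f3 = 1"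
    "ip D f2 f1 = 1" "ip D f3 f1 = 1" "ip D f3 f2 = 1"
    using dist by (auto simp: ip_def D_def f1_def f2_def f3_def \<delta>\<delta>)
  \<comment> \<open>Upper bound from the trial point \<open>w = v\<close>: a signal whose tilt
    agrees with that of the rejection vectors loses its whole rejected part, and only
    \<open>T v\<close> with the same tilt remains.\<close>
  have sound: "Re (H (tvec v c - tvec (v - T v) f) (tvec v c - tvec (v - T v) f)) + Re (k T v v)
      \<le> (1 + e) * Re (ip UNIV v (T v))"
    if "\<And>d. d \<in> D \<Longrightarrow> c d = f d" "Re (ip D f f) \<le> 1 + e" "ip D f f \<in> \<real>" for T v c f
  proof -
    have "H (tvec v c - tvec (v - T v) f) (tvec v c - tvec (v - T v) f) = H (tvec (T v) f) (tvec (T v) f)"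
      unfolding H_def by (rule ip_cong) (auto simp: tvec_def that algebra_simps)
    also have "Re \<dots> = Re (ip UNIV (T v) (T v)) * Re (ip D f f)"
      using that(3) by (simp add: H_def ip_tvec complex_is_Real_iff)
    also have "\<dots> \<le> Re (ip UNIV (T v) (T v)) * (1 + e)"
      by (rule mult_left_mono[OF that(2) ip.nonneg])
    finally show ?thesis by (simp add: k0 algebra_simps)
  qed
  show ?thesis
  proof (rule that[OF P])
    show "Re (P z z) \<le> Re (ip (UNIV \<times> {r, a, b}) z z)" for z
      using l32[of z] l21[of z] l1[of z] by (simp add: H_def D_def)
  next
    fix v :: "'z \<Rightarrow> complex" and c :: "'d \<Rightarrow> complex"
    assume c: "c r = 1" "c a = 0" "c b = complex_of_real \<delta>"
    have "Re (P (tvec v c) (tvec v c)) \<le> Re (P1 (tvec v c) (tvec v c))"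
      using l32 l21 order_trans by blast
    also have "\<dots> \<le> (1 + e) * Re (ip UNIV v (T1 v))"
      by (rule order_trans[OF le1[of _ v]], unfold s, rule sound)
        (use c dist in \<open>auto simp: D_def[symmetric] ipf, auto simp: D_def f1_def\<close>)
    finally show "Re (P (tvec v c) (tvec v c)) \<le> (1 + \<delta>\<^sup>2) * Re (ip UNIV v (T1 v))"
      by (simp add: e_def)
  next
    fix v :: "'z \<Rightarrow> complex" and c :: "'d \<Rightarrow> complex"
    assume c: "c r = 1" "c a = complex_of_real \<delta>" "c b = 0"
    have "Re (P (tvec v c) (tvec v c)) \<le> Re (P2 (tvec v c) (tvec v c))"
      by (rule l32)
    also have "\<dots> \<le> Re (H (tvec v c - s2 v) (tvec v c - s2 v)) + Re (k T2 v v)"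
      by (rule order_trans[OF le2[of _ v]]) (simp add: l1)
    also have "\<dots> \<le> (1 + e) * Re (ip UNIV v (T2 v))"
      by (unfold s, rule sound)
        (use c dist in \<open>auto simp: D_def[symmetric] ipf, auto simp: D_def f2_def\<close>)
    finally show "Re (P (tvec v c) (tvec v c)) \<le> (1 + \<delta>\<^sup>2) * Re (ip UNIV v (T2 v))"
      by (simp add: e_def)
  next
    fix v :: "'z \<Rightarrow> complex" and c :: "'d \<Rightarrow> complex"
    assume c: "c r = 1" "c a = 0" "c b = (0::complex)"
    have "Re (P (tvec v c) (tvec v c)) \<le> Re (P2 (tvec v c - s3 v) (tvec v c - s3 v)) + Re (k T3 v v)"
      by (rule le3)
    also have "\<dots> \<le> Re (H (tvec v c - s3 v) (tvec v c - s3 v)) + Re (k T3 v v)"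
      using l21[of "tvec v c - s3 v"] l1[of "tvec v c - s3 v"] by simp
    also have "\<dots> \<le> (1 + e) * Re (ip UNIV v (T3 v))"
      by (unfold s, rule sound)
        (use c dist e in \<open>auto simp: D_def[symmetric] ipf, auto simp: D_def f3_def\<close>)
    finally show "Re (P (tvec v c) (tvec v c)) \<le> (1 + \<delta>\<^sup>2) * Re (ip UNIV v (T3 v))"
      by (simp add: e_def)
  next
    fix v :: "'z \<Rightarrow> complex" and c :: "'d \<Rightarrow> complex"
    assume c: "c r = 1" "c a = complex_of_real \<delta>" "c b = complex_of_real \<delta>"
    define V where "V = tvec v c"
    \<comment> \<open>For the lower bound the three nested infima are evaluated at their
      minimisers.\<close>
    obtain w3 where w3: "Re (P V V) = Re (P2 (V - s3 w3) (V - s3 w3)) + Re (k T3 w3 w3)"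
      using ex3 by blast
    obtain w2 where w2: "Re (P2 (V - s3 w3) (V - s3 w3))
        = Re (P1 (V - s3 w3 - s2 w2) (V - s3 w3 - s2 w2)) + Re (k T2 w2 w2)"
      using ex2 by blast
    obtain w1 where w1: "Re (P1 (V - s3 w3 - s2 w2) (V - s3 w3 - s2 w2))
        = Re (H (V - s3 w3 - s2 w2 - s1 w1) (V - s3 w3 - s2 w2 - s1 w1)) + Re (k T1 w1 w1)"
      using ex1 by blast
    define x y z where xyz: "x = w3 - T3 w3" "y = w1 - T1 w1" "z = w2 - T2 w2"
    define k1 k2 k3 where kk: "k1 = Re (ip UNIV w1 (T1 w1)) - Re (ip UNIV (T1 w1) (T1 w1))"
      "k2 = Re (ip UNIV w2 (T2 w2)) - Re (ip UNIV (T2 w2) (T2 w2))"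
      "k3 = Re (ip UNIV w3 (T3 w3)) - Re (ip UNIV (T3 w3) (T3 w3))"
    have ipc: "ip D c c = of_real (1 + 2 * e)" "ip D c f3 = 1" "ip D f3 c = 1"
      "ip D c f1 = of_real (1 + e)" "ip D c f2 = of_real (1 + e)"
      "ip D f1 c = of_real (1 + e)" "ip D f2 c = of_real (1 + e)"
      using dist c by (auto simp: ip_def D_def f1_def f2_def f3_def \<delta>\<delta>)
    \<comment> \<open>Different tilt vectors have inner product 1, while \<open>f1\<close> and
      \<open>f2\<close> have squared norm \<open>1 + e\<close>. The surplus on the diagonal produces
      the terms \<open>e |y|^2\<close> and \<open>e |z|^2\<close>.\<close>
    have HV: "Re (H (V - s3 w3 - s2 w2 - s1 w1) (V - s3 w3 - s2 w2 - s1 w1))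
        = (1 + 2 * e) * Re (ip UNIV v v)
          - (2 * Re (ip UNIV v x) + 2 * (1 + e) * Re (ip UNIV v y) + 2 * (1 + e) * Re (ip UNIV v z))
          + Re (ip UNIV (x + y + z) (x + y + z)) + e * Re (ip UNIV y y) + e * Re (ip UNIV z z)"
      using ip.Re_sym[of UNIV v x] ip.Re_sym[of UNIV v y] ip.Re_sym[of UNIV v z]
      by (simp add: H_def V_def s xyz[symmetric] ip.sesq ip_tvec ipf ipc algebra_simps)
    have gap: "2 * Re (ip UNIV v x) + 2 * (1 + e) * Re (ip UNIV v y) + 2 * (1 + e) * Re (ip UNIV v z)
    \<le> Re (ip UNIV (x + y + z) (x + y + z)) + e * Re (ip UNIV y y) + e * Re (ip UNIV z z)
      + (1 + e) * (k1 + k2 + k3) + 6 / e * (Re (ip UNIV v v) - Re (ip UNIV v (T3 v)))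
      + 2 * (1 + e)\<^sup>2 / e * ((Re (ip UNIV v v) - Re (ip UNIV v (T1 v)))
          + (Re (ip UNIV v v) - Re (ip UNIV v (T2 v))))"
    proof (rule tilted_gap[OF e])
      show "k1 \<ge> 0" "k2 \<ge> 0" "k3 \<ge> 0"
        unfolding kk using effect_square_le T1 T2 T3 by (simp_all)
    qed (use e in \<open>unfold xyz kk; intro effect_compl_weighted T1 T2 T3; simp\<close>)+
    show "(1 + 2 * \<delta>\<^sup>2) * Re (ip UNIV v v) - Re (P (tvec v c) (tvec v c))
       \<le> 6 / \<delta>\<^sup>2 * (Re (ip UNIV v v) - Re (ip UNIV v (T3 v)))
        + 2 * (1 + \<delta>\<^sup>2)\<^sup>2 / \<delta>\<^sup>2 * ((Re (ip UNIV v v) - Re (ip UNIV v (T1 v)))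
            + (Re (ip UNIV v v) - Re (ip UNIV v (T2 v))))"
      using gap w1 w2 w3 HV
      unfolding k0 kk[symmetric] e_def[symmetric] V_def[symmetric] distrib_left[of "1 + e" "_ + _" _]
        distrib_left[of "1 + e" k1 k2]
      by linarith
  qed
qed

section \<open>The decoder for a fixed codebook\<close>

text \<open>A message pair is tilted in the two directions indexed by its own components, so that two
  message pairs share exactly the tilt directions of the components on which they agree.\<close>

definition tilt :: "real \<Rightarrow> nat \<Rightarrow> nat \<Rightarrow> (nat + nat) option \<Rightarrow> complex" where
  "tilt \<delta> m1 m2 d = (case d of None \<Rightarrow> 1
     | Some (Inl j) \<Rightarrow> if j = m1 then of_real \<delta> else 0
     | Some (Inr k) \<Rightarrow> if k = m2 then of_real \<delta> else 0)"

lemma tilt_simps [simp]: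
  "tilt \<delta> m1 m2 None = 1"
  "tilt \<delta> m1 m2 (Some (Inl j)) = (if j = m1 then of_real \<delta> else 0)"
  "tilt \<delta> m1 m2 (Some (Inr k)) = (if k = m2 then of_real \<delta> else 0)"
  by (simp_all add: tilt_def)

definition tilt_dirs :: "nat \<Rightarrow> nat \<Rightarrow> (nat + nat) option set" where
  "tilt_dirs M1 M2 = insert None (Some ` (Inl ` {..<M1} \<union> Inr ` {..<M2}))"

lemma ip_tilt_dirs:
  assumes "m1 < M1" "m2 < M2" and "\<And>d. d \<notin> {None, Some (Inl m1), Some (Inr m2)} \<Longrightarrow> b d = 0"
  shows "ip (tilt_dirs M1 M2) b c = cnj (b None) * c None
    + cnj (b (Some (Inl m1))) * c (Some (Inl m1)) + cnj (b (Some (Inr m2))) * c (Some (Inr m2))"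
proof -
  have "ip (tilt_dirs M1 M2) b c = (\<Sum>d\<in>{None, Some (Inl m1), Some (Inr m2)}. cnj (b d) * c d)"
    unfolding ip_def
    by (rule sum.mono_neutral_right) (use assms in \<open>auto simp: tilt_dirs_def\<close>)
  then show ?thesis by simp
qed

lemma tilt_support: "d \<notin> {None, Some (Inl m1), Some (Inr m2)} \<Longrightarrow> tilt \<delta> m1 m2 d = 0"
  by (auto simp: tilt_def split: option.splits sum.splits)

text \<open>These scalars are the squared norm of a tilted signal, the cost of undoing its tilt, and
  the norm of the untilted direction.\<close>

lemma ip_tilt:
  assumes "m1 < M1" "m2 < M2"
  shows "ip (tilt_dirs M1 M2) (tilt \<delta> m1 m2) (tilt \<delta> m1 m2) = of_real (1 + 2 * \<delta>\<^sup>2)"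
    and "ip (tilt_dirs M1 M2) (tilt \<delta> m1 m2 - unitvec None) (tilt \<delta> m1 m2 - unitvec None)
      = of_real (2 * \<delta>\<^sup>2)"
    and "ip (tilt_dirs M1 M2) (unitvec None) (unitvec None) = 1"
proof -
  have u: "unitvec None d = 0" if "d \<notin> {None, Some (Inl m1), Some (Inr m2)}" for d
    using that by (auto simp: unitvec_def)
  have t: "(tilt \<delta> m1 m2 - unitvec None) d = 0" if "d \<notin> {None, Some (Inl m1), Some (Inr m2)}" for d
    using u[OF that] tilt_support[OF that] by simp
  show "ip (tilt_dirs M1 M2) (tilt \<delta> m1 m2) (tilt \<delta> m1 m2) = of_real (1 + 2 * \<delta>\<^sup>2)"
    using ip_tilt_dirs[where b = "tilt \<delta> m1 m2" and c = "tilt \<delta> m1 m2", OF assms tilt_support]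
    by (simp add: power2_eq_square)
  show "ip (tilt_dirs M1 M2) (tilt \<delta> m1 m2 - unitvec None) (tilt \<delta> m1 m2 - unitvec None)
      = of_real (2 * \<delta>\<^sup>2)"
    using ip_tilt_dirs[where b = "tilt \<delta> m1 m2 - unitvec None" and c = "tilt \<delta> m1 m2 - unitvec None", OF assms t]
    by (simp add: unitvec_def power2_eq_square)
  show "ip (tilt_dirs M1 M2) (unitvec None) (unitvec None) = 1"
    using ip_tilt_dirs[where b = "unitvec None" and c = "unitvec None", OF assms u] by (simp add: unitvec_def)
qed

lemma sum_competitors:
  fixes f :: "nat \<times> nat \<Rightarrow> real"
  assumes "m1 < M1" "m2 < M2"
  shows "(\<Sum>m\<in>{..<M1} \<times> {..<M2} - {(m1, m2)}. f m)
    = (\<Sum>j\<in>{..<M1} - {m1}. f (j, m2)) + (\<Sum>k\<in>{..<M2} - {m2}. f (m1, k))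
      + (\<Sum>j\<in>{..<M1} - {m1}. \<Sum>k\<in>{..<M2} - {m2}. f (j, k))"
proof -
  define A B where "A = {..<M1} - {m1}" and "B = {..<M2} - {m2}"
  have AB: "finite A" "finite B" "m1 \<notin> A" "m2 \<notin> B" by (auto simp: A_def B_def)
  have "{..<M1} \<times> {..<M2} - {(m1, m2)} = (A \<times> {m2} \<union> {m1} \<times> B) \<union> A \<times> B"
    using assms by (auto simp: A_def B_def)
  also have "sum f \<dots> = sum f (A \<times> {m2}) + sum f ({m1} \<times> B) + sum f (A \<times> B)"
    using AB by (subst sum.union_disjoint; (subst sum.union_disjoint)?; force)
  also have "sum f (A \<times> {m2}) = (\<Sum>j\<in>A. f (j, m2))"
    using AB by (simp add: sum.cartesian_product')
  also have "sum f ({m1} \<times> B) = (\<Sum>k\<in>B. f (m1, k))"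
    using AB by (simp add: sum.cartesian_product')
  also have "sum f (A \<times> B) = (\<Sum>j\<in>A. \<Sum>k\<in>B. f (j, k))"
    using AB by (simp add: sum.cartesian_product')
  finally show ?thesis by (simp add: A_def B_def)
qed

text \<open>The joint tests, extended to all tilt directions, are run sequentially on the enlarged
  space, and the resulting POVM is restricted to untilted signals. The factor 8 is 4 from the union
  bound times 2 from passing between tilted and untilted signal, which also costs the last
  term.\<close>

lemma tilted_decoder:
  fixes T1 T2 T3 :: "nat \<Rightarrow> nat \<Rightarrow> ('z::finite \<Rightarrow> complex) \<Rightarrow> 'z \<Rightarrow> complex" and \<delta> :: real
  assumes T: "\<And>j k. j < M1 \<Longrightarrow> k < M2 \<Longrightarrow> effect UNIV (T1 j k)"
    "\<And>j k. j < M1 \<Longrightarrow> k < M2 \<Longrightarrow> effect UNIV (T2 j k)"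
    "\<And>j k. j < M1 \<Longrightarrow> k < M2 \<Longrightarrow> effect UNIV (T3 j k)"
    and M: "M1 > 0" "M2 > 0" and \<delta>: "0 < \<delta>" "\<delta> \<le> 1"
  obtains L where "\<And>m1 m2. m1 < M1 \<Longrightarrow> m2 < M2 \<Longrightarrow> psd_form (L m1 m2)"
    "\<And>u v. (\<Sum>m1<M1. \<Sum>m2<M2. L m1 m2 u v) = ip UNIV u v"
    "\<And>m1 m2 v. m1 < M1 \<Longrightarrow> m2 < M2 \<Longrightarrow> Re (ip UNIV v v) - Re (L m1 m2 v v)
      \<le> 8 * (6 / \<delta>\<^sup>2 * (Re (ip UNIV v v) - Re (ip UNIV v (T3 m1 m2 v)))
          + 2 * (1 + \<delta>\<^sup>2)\<^sup>2 / \<delta>\<^sup>2 * ((Re (ip UNIV v v) - Re (ip UNIV v (T1 m1 m2 v)))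
              + (Re (ip UNIV v v) - Re (ip UNIV v (T2 m1 m2 v))))
          + (1 + \<delta>\<^sup>2) * ((\<Sum>j\<in>{..<M1} - {m1}. Re (ip UNIV v (T1 j m2 v)))
              + (\<Sum>k\<in>{..<M2} - {m2}. Re (ip UNIV v (T2 m1 k v)))
              + (\<Sum>j\<in>{..<M1} - {m1}. \<Sum>k\<in>{..<M2} - {m2}. Re (ip UNIV v (T3 j k v)))))
        + 4 * \<delta>\<^sup>2 * Re (ip UNIV v v)"
proof -
  define I where "I = {..<M1} \<times> {..<M2}"
  define S where "S = (UNIV :: 'z set) \<times> tilt_dirs M1 M2"
  have S: "finite S" by (simp add: S_def tilt_dirs_def)
  define gap where "gap = (\<lambda>m1 m2 v. 6 / \<delta>\<^sup>2 * (Re (ip UNIV v v) - Re (ip UNIV v (T3 m1 m2 v)))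
          + 2 * (1 + \<delta>\<^sup>2)\<^sup>2 / \<delta>\<^sup>2 * ((Re (ip UNIV v v) - Re (ip UNIV v (T1 m1 m2 v)))
              + (Re (ip UNIV v v) - Re (ip UNIV v (T2 m1 m2 v)))))"
  \<comment> \<open>The test of the pair \<open>(j, k)\<close> as seen by every signal: one that
    agrees only in \<open>k\<close> meets \<open>T1\<close>, one that agrees only in
    \<open>j\<close> meets \<open>T2\<close>, one that agrees in neither meets \<open>T3\<close>,
    and the last clause bounds the loss of the correct signal.\<close>
  define good where "good = (\<lambda>j k E. effect S E \<and>
    (\<forall>v m1. m1 \<noteq> j \<longrightarrow> Re (ip S (tvec v (tilt \<delta> m1 k)) (E (tvec v (tilt \<delta> m1 k))))
        \<le> (1 + \<delta>\<^sup>2) * Re (ip UNIV v (T1 j k v))) \<and>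
    (\<forall>v m2. m2 \<noteq> k \<longrightarrow> Re (ip S (tvec v (tilt \<delta> j m2)) (E (tvec v (tilt \<delta> j m2))))
        \<le> (1 + \<delta>\<^sup>2) * Re (ip UNIV v (T2 j k v))) \<and>
    (\<forall>v m1 m2. m1 \<noteq> j \<longrightarrow> m2 \<noteq> k \<longrightarrow>
      Re (ip S (tvec v (tilt \<delta> m1 m2)) (E (tvec v (tilt \<delta> m1 m2))))
        \<le> (1 + \<delta>\<^sup>2) * Re (ip UNIV v (T3 j k v))) \<and>
    (\<forall>v. (1 + 2 * \<delta>\<^sup>2) * Re (ip UNIV v v)
        - Re (ip S (tvec v (tilt \<delta> j k)) (E (tvec v (tilt \<delta> j k)))) \<le> gap j k v))"
  have "\<exists>E. good j k E" if jk: "j < M1" "k < M2" for j k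
  proof (rule joint_test[OF T(1)[OF jk] T(2)[OF jk] T(3)[OF jk] \<delta>,
        of "None :: (nat + nat) option" "Some (Inl j)" "Some (Inr k)"])
    fix P :: "('z \<times> (nat + nat) option \<Rightarrow> complex) \<Rightarrow> ('z \<times> (nat + nat) option \<Rightarrow> complex) \<Rightarrow> complex"
    assume P: "psd_form P"
      and le: "\<And>z. Re (P z z) \<le> Re (ip (UNIV \<times> {None, Some (Inl j), Some (Inr k)}) z z)"
      and P1: "\<And>v c. c None = 1 \<Longrightarrow> c (Some (Inl j)) = 0 \<Longrightarrow> c (Some (Inr k)) = of_real \<delta> \<Longrightarrow>
         Re (P (tvec v c) (tvec v c)) \<le> (1 + \<delta>\<^sup>2) * Re (ip UNIV v (T1 j k v))"
      and P2: "\<And>v c. c None = 1 \<Longrightarrow> c (Some (Inl j)) = of_real \<delta> \<Longrightarrow> c (Some (Inr k)) = 0 \<Longrightarrow>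
         Re (P (tvec v c) (tvec v c)) \<le> (1 + \<delta>\<^sup>2) * Re (ip UNIV v (T2 j k v))"
      and P3: "\<And>v c. c None = 1 \<Longrightarrow> c (Some (Inl j)) = 0 \<Longrightarrow> c (Some (Inr k)) = 0 \<Longrightarrow>
         Re (P (tvec v c) (tvec v c)) \<le> (1 + \<delta>\<^sup>2) * Re (ip UNIV v (T3 j k v))"
      and P0: "\<And>v c. c None = 1 \<Longrightarrow> c (Some (Inl j)) = of_real \<delta> \<Longrightarrow> c (Some (Inr k)) = of_real \<delta> \<Longrightarrow>
         (1 + 2 * \<delta>\<^sup>2) * Re (ip UNIV v v) - Re (P (tvec v c) (tvec v c))
         \<le> 6 / \<delta>\<^sup>2 * (Re (ip UNIV v v) - Re (ip UNIV v (T3 j k v)))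
          + 2 * (1 + \<delta>\<^sup>2)\<^sup>2 / \<delta>\<^sup>2 * ((Re (ip UNIV v v) - Re (ip UNIV v (T1 j k v)))
              + (Re (ip UNIV v v) - Re (ip UNIV v (T2 j k v))))"
    have "Re (P z z) \<le> Re (ip S z z)" for z
      by (rule order_trans[OF le ip_mono[OF S]]) (use jk in \<open>auto simp: S_def tilt_dirs_def\<close>)
    then obtain E where "effect S E" "\<And>u v. ip S u (E v) = P u v"
      using psd_form_to_effect[OF P S] by blast
    then show "\<exists>E. good j k E" using P1 P2 P3 P0
      by (intro exI[of _ E]) (simp add: good_def gap_def)
  qed simp_all
  then have "\<exists>E. \<forall>j k. j < M1 \<longrightarrow> k < M2 \<longrightarrow> good j k (E j k)"
    by metis
  then obtain E where E: "\<And>j k. j < M1 \<Longrightarrow> k < M2 \<Longrightarrow> good j k (E j k)"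
    by blast
  obtain L where L: "\<And>m. m \<in> I \<Longrightarrow> psd_form (L m)"
    and tot: "\<And>u v. (\<Sum>m\<in>I. L m u v) = ip S u v"
    and err: "\<And>m v. m \<in> I \<Longrightarrow> Re (ip S v v) - Re (L m v v)
       \<le> 4 * (Re (ip S v v) - Re (ip S v (case_prod E m v)) + (\<Sum>j\<in>I - {m}. Re (ip S v (case_prod E j v))))"
    using sequential_decoder_set[of I S "case_prod E"] E M
    by (auto simp: I_def good_def lessThan_empty_iff)
  \<comment> \<open>The isometric embedding of the original space without tilt; composing with it
    turns a POVM on the enlarged space into one on the output system.\<close>
  define J where "J = (\<lambda>v :: 'z \<Rightarrow> complex. tvec v (unitvec (None :: (nat + nat) option)))"
  have J: "clinear_map J" unfolding J_def by (rule clinear_tvec)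
  show ?thesis
  proof (rule that[of "\<lambda>m1 m2 u v. L (m1, m2) (J u) (J v)"])
    show "psd_form (\<lambda>u v. L (m1, m2) (J u) (J v))" if "m1 < M1" "m2 < M2" for m1 m2
      using that by (intro psd_form_comp[OF L J]) (simp add: I_def)
    show "(\<Sum>m1<M1. \<Sum>m2<M2. L (m1, m2) (J u) (J v)) = ip UNIV u v" for u v
      using tot[of "J u" "J v"] ip_tilt(3)[OF M]
      by (simp add: I_def sum.cartesian_product' S_def J_def ip_tvec)
    fix m1 m2 and v :: "'z \<Rightarrow> complex"
    assume m: "m1 < M1" "m2 < M2"
    have mI: "(m1, m2) \<in> I" using m by (simp add: I_def)
    define V where "V = tvec v (tilt \<delta> m1 m2)"
    have V: "Re (ip S V V) = (1 + 2 * \<delta>\<^sup>2) * Re (ip UNIV v v)"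
      unfolding V_def S_def ip_tvec ip_tilt(1)[OF m] by simp
    have VJ: "Re (ip S (V - J v) (V - J v)) = 2 * \<delta>\<^sup>2 * Re (ip UNIV v v)"
      unfolding V_def J_def S_def tvec_diff_right[symmetric] ip_tvec ip_tilt(2)[OF m] by simp
    have JJ: "ip S (J v) (J v) = ip UNIV v v"
      unfolding J_def S_def ip_tvec ip_tilt(3)[OF m] by simp
    \<comment> \<open>The failure form of the decoder. Positivity allows the comparison of its
      values at \<open>J v\<close> and at the tilted \<open>V\<close>; being at most the inner
      product, it charges only the squared norm of \<open>V - J v\<close>.\<close>
    define G where "G = (\<lambda>u v. ip S u v - L (m1, m2) u v)"
    have G: "psd_form G" unfolding G_def
    proof (rule psd_form_diff[OF psd_form_ip L[OF mI]])
      fix w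
      have "Re (L (m1, m2) w w) \<le> (\<Sum>m\<in>I. Re (L m w w))"
        by (rule member_le_sum) (use mI psd_form.nonneg[OF L] in \<open>auto simp: I_def\<close>)
      also have "\<dots> = Re (ip S w w)" by (simp flip: tot)
      finally show "Re (L (m1, m2) w w) \<le> Re (ip S w w)" .
    qed
    have "Re (G (J v) (J v)) \<le> 2 * Re (G V V) + 2 * Re (G (V - J v) (V - J v))"
      by (rule psd_form.le_twice[OF G])
    also have "Re (G (V - J v) (V - J v)) \<le> 2 * \<delta>\<^sup>2 * Re (ip UNIV v v)"
      using psd_form.nonneg[OF L[OF mI], of "V - J v"] by (simp add: G_def VJ)
    also have "Re (G V V) \<le> 4 * (Re (ip S V V) - Re (ip S V (E m1 m2 V))
        + (\<Sum>j\<in>I - {(m1, m2)}. Re (ip S V (case_prod E j V))))"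
      using err[OF mI, of V] by (simp add: G_def)
    also have "Re (ip S V V) - Re (ip S V (E m1 m2 V)) \<le> gap m1 m2 v"
      unfolding V using E[OF m] by (simp add: good_def V_def)
    also have "(\<Sum>j\<in>I - {(m1, m2)}. Re (ip S V (case_prod E j V)))
        = (\<Sum>j\<in>{..<M1} - {m1}. Re (ip S V (E j m2 V))) + (\<Sum>k\<in>{..<M2} - {m2}. Re (ip S V (E m1 k V)))
      + (\<Sum>j\<in>{..<M1} - {m1}. \<Sum>k\<in>{..<M2} - {m2}. Re (ip S V (E j k V)))"
      unfolding I_def by (subst sum_competitors[OF m]) simp
    also have "(\<Sum>j\<in>{..<M1} - {m1}. Re (ip S V (E j m2 V)))
        \<le> (1 + \<delta>\<^sup>2) * (\<Sum>j\<in>{..<M1} - {m1}. Re (ip UNIV v (T1 j m2 v)))"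
      unfolding sum_distrib_left
      by (rule sum_mono) (use E m in \<open>auto simp: good_def V_def\<close>)
    also have "(\<Sum>k\<in>{..<M2} - {m2}. Re (ip S V (E m1 k V)))
        \<le> (1 + \<delta>\<^sup>2) * (\<Sum>k\<in>{..<M2} - {m2}. Re (ip UNIV v (T2 m1 k v)))"
      unfolding sum_distrib_left
      by (rule sum_mono) (use E m in \<open>auto simp: good_def V_def\<close>)
    also have "(\<Sum>j\<in>{..<M1} - {m1}. \<Sum>k\<in>{..<M2} - {m2}. Re (ip S V (E j k V)))
        \<le> (1 + \<delta>\<^sup>2) * (\<Sum>j\<in>{..<M1} - {m1}. \<Sum>k\<in>{..<M2} - {m2}. Re (ip UNIV v (T3 j k v)))"
      unfolding sum_distrib_left
      by (intro sum_mono) (use E m in \<open>auto simp: good_def V_def\<close>)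
    finally have fin: "Re (G (J v) (J v)) \<le> 2 * (4 * (gap m1 m2 v + ((1 + \<delta>\<^sup>2) * (\<Sum>j\<in>{..<M1} - {m1}. Re (ip UNIV v (T1 j m2 v)))
        + (1 + \<delta>\<^sup>2) * (\<Sum>k\<in>{..<M2} - {m2}. Re (ip UNIV v (T2 m1 k v)))
        + (1 + \<delta>\<^sup>2) * (\<Sum>j\<in>{..<M1} - {m1}. \<Sum>k\<in>{..<M2} - {m2}. Re (ip UNIV v (T3 j k v))))))
        + 2 * (2 * \<delta>\<^sup>2 * Re (ip UNIV v v))"
      by simp
    show "Re (ip UNIV v v) - Re (L (m1, m2) (J v) (J v))
      \<le> 8 * (6 / \<delta>\<^sup>2 * (Re (ip UNIV v v) - Re (ip UNIV v (T3 m1 m2 v)))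
          + 2 * (1 + \<delta>\<^sup>2)\<^sup>2 / \<delta>\<^sup>2 * ((Re (ip UNIV v v) - Re (ip UNIV v (T1 m1 m2 v)))
              + (Re (ip UNIV v v) - Re (ip UNIV v (T2 m1 m2 v))))
          + (1 + \<delta>\<^sup>2) * ((\<Sum>j\<in>{..<M1} - {m1}. Re (ip UNIV v (T1 j m2 v)))
              + (\<Sum>k\<in>{..<M2} - {m2}. Re (ip UNIV v (T2 m1 k v)))
              + (\<Sum>j\<in>{..<M1} - {m1}. \<Sum>k\<in>{..<M2} - {m2}. Re (ip UNIV v (T3 j k v)))))
        + 4 * \<delta>\<^sup>2 * Re (ip UNIV v v)"
      using fin unfolding gap_def G_def JJ minus_complex.simps distrib_left[of "1 + \<delta>\<^sup>2" "_ + _" _]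
        distrib_left[of "1 + \<delta>\<^sup>2" "sum _ _" "sum _ _"]
      by linarith
  qed
qed

section \<open>Matrices\<close>

definition opapp :: "('i::finite) op \<Rightarrow> ('i \<Rightarrow> complex) \<Rightarrow> 'i \<Rightarrow> complex" where
  "opapp A v = (\<lambda>i. \<Sum>j\<in>UNIV. A i j * v j)"

lemma ip_opapp: "ip UNIV u (opapp A v) = (\<Sum>i\<in>UNIV. \<Sum>j\<in>UNIV. cnj (u i) * A i j * v j)"
  by (simp add: ip_def opapp_def sum_distrib_left mult.assoc)

lemma clinear_opapp: "clinear_map (opapp A)"
  by (auto simp: clinear_map_def opapp_def fun_eq_iff algebra_simps sum.distrib sum_distrib_left)

lemma opapp_unitvec: "opapp A (unitvec j) = (\<lambda>i. A i j)"
  by (simp add: opapp_def unitvec_def if_distrib[of "\<lambda>x. _ * x"] cong: if_cong)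

lemma ip_unitvec_left: "ip UNIV (unitvec i) v = v (i::'i::finite)"
  by (simp add: ip_def unitvec_def if_distrib[of "\<lambda>x. x * _"] if_distrib[of cnj] cong: if_cong)

text \<open>Hermiticity of the form comes from polarisation: real values at \<open>u + v\<close> and
  \<open>u + \<i> v\<close> fix the imaginary and the real part of \<open>B u v\<close>.\<close>

lemma psd_iff_form: "psd A \<longleftrightarrow> psd_form (\<lambda>u v. ip UNIV u (opapp A v))"
proof
  assume "psd_form (\<lambda>u v. ip UNIV u (opapp A v))"
  then interpret psd_form "\<lambda>u v. ip UNIV u (opapp A v)" .
  show "psd A"
    unfolding psd_def psd_on_def ip_opapp[symmetric]
    using diag_real nonneg by (metis Reals_of_real)
next
  assume "psd A"
  define b where "b = (\<lambda>u v. ip UNIV u (opapp A v))"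
  have real: "Im (b v v) = 0" and nn: "0 \<le> Re (b v v)" for v
    using \<open>psd A\<close> unfolding psd_def psd_on_def ip_opapp[symmetric] b_def
    by (auto simp: complex_is_Real_iff)
  have add: "b u (v + w) = b u v + b u w" "b (u + v) w = b u w + b v w"
    "b u (csc c v) = c * b u v" "b (csc c u) v = cnj c * b u v" for u v w c
    by (simp_all add: b_def clinear_map_add[OF clinear_opapp] clinear_map_csc[OF clinear_opapp] ip.sesq)
  have herm: "cnj (b u v) = b v u" for u v
  proof -
    have "Im (b u v) + Im (b v u) = 0"
      using real[of "u + v"] real[of u] real[of v] by (simp add: add)
    moreover have "Re (b u v) - Re (b v u) = 0"
      using real[of "u + csc \<i> v"] real[of u] real[of v] by (simp add: add)
    ultimately show ?thesis by (simp add: complex_eq_iff)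
  qed
  have "psd_form b" by unfold_locales (auto simp: add herm nn)
  then show "psd_form (\<lambda>u v. ip UNIV u (opapp A v))" by (simp add: b_def)
qed

lemma opapp_opminus: "opapp (opminus A B) v = opapp A v - opapp B v"
  by (auto simp: opapp_def opminus_def fun_eq_iff algebra_simps sum_subtractf)

lemma opapp_idop: "opapp idop v = v"
  by (simp add: opapp_def idop_def fun_eq_iff if_distrib[of "\<lambda>x. x * _"] cong: if_cong)

lemma effect_opapp:
  assumes "psd T" "psd (opminus idop T)"
  shows "effect UNIV (opapp T)"
proof -
  have "0 \<le> Re (ip UNIV v (opapp (opminus idop T) v))" for v
    by (rule psd_form.nonneg[OF assms(2)[unfolded psd_iff_form]])
  then show ?thesis
    using assms(1) by (auto simp: effect_def clinear_opapp psd_iff_form opapp_opminus opapp_idop ip.sesq)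
qed

text \<open>Cholesky factorisation: each Schur complement splits off a form of rank at most one and
  annihilates one more basis vector, without disturbing those already annihilated.\<close>

lemma psd_form_gram:
  fixes B :: "('i \<Rightarrow> complex) \<Rightarrow> ('i \<Rightarrow> complex) \<Rightarrow> complex"
  assumes "finite J" "psd_form B"
  shows "\<exists>B' n (w :: nat \<Rightarrow> 'i \<Rightarrow> complex). psd_form B' \<and> (\<forall>j\<in>J. \<forall>v. B' (unitvec j) v = 0) \<and>
    (\<forall>i j. B (unitvec i) (unitvec j) = B' (unitvec i) (unitvec j) + (\<Sum>k<n. cnj (w k i) * w k j))"
  using assms(1)
proof (induction J rule: finite_induct)
  case empty
  show ?case by (intro exI[of _ B] exI[of _ "0::nat"] exI[of _ "\<lambda>_ _. 0"]) (simp add: assms(2))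
next
  case (insert a J)
  from insert.IH obtain B1 and n :: nat and w where B1: "psd_form B1" and z: "\<forall>j\<in>J. \<forall>v. B1 (unitvec j) v = 0"
    and eq: "\<forall>i j. B (unitvec i) (unitvec j) = B1 (unitvec i) (unitvec j) + (\<Sum>k<n. cnj (w k i) * w k j)"
    by (elim exE conjE)
  interpret B1: psd_form B1 by fact
  define e where "e = (unitvec a :: 'i \<Rightarrow> complex)"
  define r where "r = Re (B1 e e)"
  have r: "B1 e e = of_real r" "r \<ge> 0" using B1.diag_real B1.nonneg by (auto simp: r_def)
  obtain B2 where B2: "psd_form B2" "\<And>u v. B2 u v = B1 u v - B1 u e * B1 e v / B1 e e"
    using psd_form_eliminate_vector[OF B1, of e] by metis
  have ze: "B2 e v = 0" for v
  proof (cases "r = 0")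
    case True
    then have "B1 e v = 0" using B1.null_left[of e v] by (simp add: r_def)
    then show ?thesis by (simp add: B2)
  qed (simp add: B2 r)
  \<comment> \<open>For \<open>r = 0\<close> the convention \<open>x / 0 = 0\<close> makes this
    vector zero, in accordance with the vanishing correction term.\<close>
  define w' where "w' = w(n := \<lambda>i. B1 e (unitvec i) / of_real (sqrt r))"
  have "B1 u e * B1 e v / B1 e e = cnj (B1 e u / of_real (sqrt r)) * (B1 e v / of_real (sqrt r))" for u v
    using r by (simp add: B1.herm flip: of_real_mult)
  then have "B (unitvec i) (unitvec j) = B2 (unitvec i) (unitvec j) + (\<Sum>k<Suc n. cnj (w' k i) * w' k j)" for i j
    by (simp add: eq B2 w'_def)
  moreover have "B2 (unitvec j) v = 0" if "j \<in> insert a J" for j v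
    using that ze z by (auto simp: e_def B2)
  ultimately show ?case using B2(1)
    by (intro exI[of _ B2] exI[of _ "Suc n"] exI[of _ w']) simp
qed

text \<open>Once all basis vectors are annihilated there is no remainder. The decomposition writes a
  state as a finite sum of unnormalised pure states, so inequalities for quadratic forms pass to
  traces.\<close>

lemma psd_gram:
  fixes A :: "('i::finite) op"
  assumes "psd A"
  obtains n :: nat and u :: "nat \<Rightarrow> 'i \<Rightarrow> complex" where "\<forall>i j. A i j = (\<Sum>k<n. u k i * cnj (u k j))"
proof -
  obtain B' and n :: nat and w where "psd_form B'" and z: "\<forall>j\<in>UNIV. \<forall>v. B' (unitvec j) v = (0::complex)"
    and eq: "\<forall>i j. ip UNIV (unitvec i) (opapp A (unitvec j))
      = B' (unitvec i) (unitvec j) + (\<Sum>k<n. cnj (w k i) * w k j)"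
    using psd_form_gram[OF finite_class.finite_UNIV assms[unfolded psd_iff_form]]
    by (elim exE conjE)
  show ?thesis
    by (rule that[of "\<lambda>k i. cnj (w k i)" n]) (use eq z in \<open>simp add: ip_unitvec_left opapp_unitvec\<close>)
qed

lemma psd_of_gram:
  fixes A :: "('i::finite) op"
  assumes "finite K" "\<And>i j. A i j = (\<Sum>k\<in>K. u k i * cnj (u k j))"
  shows "psd A"
proof -
  have "ip UNIV x (opapp A y) = (\<Sum>k\<in>K. cnj (ip UNIV (u k) x) * ip UNIV (u k) y)" for x y
  proof -
    have "ip UNIV x (opapp A y) = (\<Sum>i\<in>UNIV. \<Sum>j\<in>UNIV. \<Sum>k\<in>K. (u k i * cnj (x i)) * (cnj (u k j) * y j))"
      by (simp add: ip_opapp assms(2) sum_distrib_left sum_distrib_right mult_ac)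
    also have "\<dots> = (\<Sum>k\<in>K. \<Sum>i\<in>UNIV. \<Sum>j\<in>UNIV. (u k i * cnj (x i)) * (cnj (u k j) * y j))"
      by (subst sum.swap[of _ K]) (simp add: sum.swap[of _ K])
    also have "\<dots> = (\<Sum>k\<in>K. cnj (ip UNIV (u k) x) * ip UNIV (u k) y)"
      by (simp add: ip_def sum_product)
    finally show ?thesis .
  qed
  then have "psd_form (\<lambda>x y. ip UNIV x (opapp A y))"
    by unfold_locales (auto simp: ip.sesq algebra_simps sum.distrib sum_distrib_left
        intro!: sum_nonneg add_nonneg_nonneg)
  then show ?thesis by (simp add: psd_iff_form)
qed

lemma psd_tensor:
  fixes A :: "('i::finite) op" and B :: "('j::finite) op"
  assumes "psd A" "psd B"
  shows "psd (tensor A B)"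
proof -
  obtain n u where u: "\<forall>i j. A i j = (\<Sum>k<(n::nat). u k i * cnj (u k j))"
    by (rule psd_gram[OF assms(1)])
  obtain m v where v: "\<forall>i j. B i j = (\<Sum>k<(m::nat). v k i * cnj (v k j))"
    by (rule psd_gram[OF assms(2)])
  show ?thesis
  proof (rule psd_of_gram[of "{..<n} \<times> {..<m}" _ "\<lambda>(k, l) (i, j). u k i * v l j"])
    fix a b :: "'i \<times> 'j"
    obtain i j i' j' where ab: "a = (i, j)" "b = (i', j')" by fastforce
    have "tensor A B a b = (\<Sum>k<n. \<Sum>l<m. (u k i * cnj (u k i')) * (v l j * cnj (v l j')))"
      unfolding ab tensor_def prod.case u[rule_format] v[rule_format] sum_product ..
    also have "\<dots> = (\<Sum>k<n. \<Sum>l<m. (u k i * v l j) * cnj (u k i' * v l j'))"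
      by (intro sum.cong refl) (simp only: complex_cnj_mult mult_ac)
    finally show "tensor A B a b = (\<Sum>k\<in>{..<n} \<times> {..<m}. (case k of (k, l) \<Rightarrow> \<lambda>(i, j). u k i * v l j) a
        * cnj ((case k of (k, l) \<Rightarrow> \<lambda>(i, j). u k i * v l j) b))"
      by (simp add: ab sum.cartesian_product')
  qed simp
qed

section \<open>States and channels\<close>

lemma trace_tensor: "trace (tensor A B) = trace A * trace B"
  by (simp add: trace_def tensor_def sum_product sum.cartesian_product split_def)

lemma density_tensor: "density A \<Longrightarrow> density B \<Longrightarrow> density (tensor A B)"
  by (simp add: density_def psd_tensor trace_tensor)

text \<open>Complete positivity with a one-dimensional ancilla is positivity.\<close>

lemma quantum_channel_density:
  assumes C: "quantum_channel C" and "density A"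
  shows "density (C A)"
proof -
  have one: "{..<1::nat} = {0}" by auto
  have "psd A" using assms by (simp add: density_def)
  have "psd_on ({..<1::nat} \<times> UNIV) (\<lambda>(r, a) (r', b). A a b)"
    unfolding psd_on_def
  proof (rule allI)
    fix v :: "nat \<times> 'a \<Rightarrow> complex"
    show "(\<Sum>i\<in>{..<1} \<times> UNIV. \<Sum>j\<in>{..<1} \<times> UNIV. cnj (v i) * (case i of (r, a) \<Rightarrow> \<lambda>(r', b). A a b) j * v j) \<in> \<real> \<and>
      0 \<le> Re (\<Sum>i\<in>{..<1} \<times> UNIV. \<Sum>j\<in>{..<1} \<times> UNIV. cnj (v i) * (case i of (r, a) \<Rightarrow> \<lambda>(r', b). A a b) j * v j)"
      using \<open>psd A\<close>[unfolded psd_def psd_on_def, rule_format, of "\<lambda>a. v (0, a)"]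
      unfolding one by (simp add: sum.cartesian_product')
  qed
  moreover have "completely_positive C" using C by (simp add: quantum_channel_def)
  ultimately have cp: "psd_on ({..<1} \<times> UNIV) (\<lambda>(r::nat, k) (r'::nat, k'). C A k k')"
    unfolding completely_positive_def by (force simp: split_def)
  have "psd (C A)"
    unfolding psd_def psd_on_def
  proof (rule allI)
    fix v :: "'b \<Rightarrow> complex"
    show "(\<Sum>i\<in>UNIV. \<Sum>j\<in>UNIV. cnj (v i) * C A i j * v j) \<in> \<real> \<and>
      0 \<le> Re (\<Sum>i\<in>UNIV. \<Sum>j\<in>UNIV. cnj (v i) * C A i j * v j)"
      using cp[unfolded psd_on_def, rule_format, of "\<lambda>(r, k). v k"]
      unfolding one by (simp add: sum.cartesian_product')
  qed
  then show ?thesis using assms by (simp add: density_def quantum_channel_def)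
qed

lemma trace_gram:
  assumes "\<And>i j. A i j = (\<Sum>k<(n::nat). u k i * cnj (u k j))"
  shows "trace (opmult X A) = (\<Sum>k<n. ip UNIV (u k) (opapp X (u k)))"
proof -
  have "trace (opmult X A) = (\<Sum>i\<in>UNIV. \<Sum>j\<in>UNIV. \<Sum>k<n. cnj (u k i) * X i j * u k j)"
    by (simp add: trace_def opmult_def assms sum_distrib_left mult_ac)
  also have "\<dots> = (\<Sum>k<n. \<Sum>i\<in>UNIV. \<Sum>j\<in>UNIV. cnj (u k i) * X i j * u k j)"
    by (subst sum.swap[of _ "{..<n}"]) (simp add: sum.swap[of _ "{..<n}"])
  finally show ?thesis by (simp add: ip_opapp)
qed

lemma form_eq_opapp:
  fixes L :: "('i::finite \<Rightarrow> complex) \<Rightarrow> ('i \<Rightarrow> complex) \<Rightarrow> complex"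
  assumes "psd_form L"
  shows "ip UNIV u (opapp (\<lambda>i j. L (unitvec i) (unitvec j)) v) = L u v"
proof -
  interpret psd_form L by fact
  have expand: "w = (\<lambda>i. \<Sum>k\<in>UNIV. csc (w k) (unitvec k) i)" for w :: "'i \<Rightarrow> complex"
    by (simp add: fun_eq_iff unitvec_def if_distrib[of "\<lambda>x. _ * x"] cong: if_cong)
  have left: "L w x = (\<Sum>k\<in>UNIV. cnj (w k) * L (unitvec k) x)" for w x
    by (subst expand[of w], subst sum_left) (simp_all add: csc_left)
  have right: "L x w = (\<Sum>k\<in>UNIV. L x (unitvec k) * w k)" for w x
    using arg_cong[OF left[of w x], of cnj] by (simp add: herm mult.commute)
  show ?thesis
    by (subst left, subst right) (simp add: ip_opapp sum_distrib_left mult.assoc)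
qed

section \<open>The decoder in terms of traces\<close>

definition Tr :: "('i::finite) op \<Rightarrow> 'i op \<Rightarrow> real" where
  "Tr X A = Re (trace (opmult X A))"

lemma Tr_diff_idop: "density A \<Longrightarrow> Tr (opminus idop X) A = 1 - Tr X A"
proof -
  assume "density A"
  have "trace (opmult (opminus idop X) A) = trace A - trace (opmult X A)"
    by (simp add: trace_def opmult_def opminus_def idop_def left_diff_distrib sum_subtractf
        if_distrib[of "\<lambda>x. x * _"] cong: if_cong)
  then show ?thesis using \<open>density A\<close> by (simp add: Tr_def density_def)
qed

text \<open>The quadratic bound of \<open>tilted_decoder\<close>, summed over the Gram vectors of
  \<rho>, whose squared norms add up to 1. It holds for every state, so that averaging over
  codebooks can be done afterwards.\<close>

lemma codebook_decoder:
  fixes T1 T2 T3 :: "nat \<Rightarrow> nat \<Rightarrow> ('z::finite) op" and \<delta> :: real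
  assumes T: "\<And>j k. psd (T1 j k) \<and> psd (opminus idop (T1 j k))"
    "\<And>j k. psd (T2 j k) \<and> psd (opminus idop (T2 j k))"
    "\<And>j k. psd (T3 j k) \<and> psd (opminus idop (T3 j k))"
    and M: "M1 > 0" "M2 > 0" and \<delta>: "0 < \<delta>" "\<delta> \<le> 1"
  obtains \<Lambda> where "\<And>m1 m2. m1 < M1 \<Longrightarrow> m2 < M2 \<Longrightarrow> psd (\<Lambda> m1 m2)"
    "\<And>i j. (\<Sum>m1<M1. \<Sum>m2<M2. \<Lambda> m1 m2 i j) = idop i j"
    "\<And>m1 m2 \<rho>. m1 < M1 \<Longrightarrow> m2 < M2 \<Longrightarrow> density \<rho> \<Longrightarrow> Tr (opminus idop (\<Lambda> m1 m2)) \<rho>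
      \<le> 8 * (6 / \<delta>\<^sup>2 * (1 - Tr (T3 m1 m2) \<rho>)
          + 2 * (1 + \<delta>\<^sup>2)\<^sup>2 / \<delta>\<^sup>2 * ((1 - Tr (T1 m1 m2) \<rho>) + (1 - Tr (T2 m1 m2) \<rho>))
          + (1 + \<delta>\<^sup>2) * ((\<Sum>j\<in>{..<M1} - {m1}. Tr (T1 j m2) \<rho>)
              + (\<Sum>k\<in>{..<M2} - {m2}. Tr (T2 m1 k) \<rho>)
              + (\<Sum>j\<in>{..<M1} - {m1}. \<Sum>k\<in>{..<M2} - {m2}. Tr (T3 j k) \<rho>)))
        + 4 * \<delta>\<^sup>2"
proof -
  obtain L where L: "\<And>m1 m2. m1 < M1 \<Longrightarrow> m2 < M2 \<Longrightarrow> psd_form (L m1 m2)"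
    and tot: "\<And>u v. (\<Sum>m1<M1. \<Sum>m2<M2. L m1 m2 u v) = ip UNIV u v"
    and err: "\<And>m1 m2 v. m1 < M1 \<Longrightarrow> m2 < M2 \<Longrightarrow> Re (ip UNIV v v) - Re (L m1 m2 v v)
      \<le> 8 * (6 / \<delta>\<^sup>2 * (Re (ip UNIV v v) - Re (ip UNIV v (opapp (T3 m1 m2) v)))
          + 2 * (1 + \<delta>\<^sup>2)\<^sup>2 / \<delta>\<^sup>2 * ((Re (ip UNIV v v) - Re (ip UNIV v (opapp (T1 m1 m2) v)))
              + (Re (ip UNIV v v) - Re (ip UNIV v (opapp (T2 m1 m2) v))))
          + (1 + \<delta>\<^sup>2) * ((\<Sum>j\<in>{..<M1} - {m1}. Re (ip UNIV v (opapp (T1 j m2) v)))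
              + (\<Sum>k\<in>{..<M2} - {m2}. Re (ip UNIV v (opapp (T2 m1 k) v)))
              + (\<Sum>j\<in>{..<M1} - {m1}. \<Sum>k\<in>{..<M2} - {m2}. Re (ip UNIV v (opapp (T3 j k) v)))))
        + 4 * \<delta>\<^sup>2 * Re (ip UNIV v v)"
    by (rule tilted_decoder[where ?M1.0 = M1 and ?M2.0 = M2 and \<delta> = \<delta>
          and ?T1.0 = "\<lambda>j k. opapp (T1 j k)" and ?T2.0 = "\<lambda>j k. opapp (T2 j k)"
          and ?T3.0 = "\<lambda>j k. opapp (T3 j k)"])
      (use T M \<delta> in \<open>blast intro: effect_opapp\<close>)+
  define \<Lambda> where "\<Lambda> = (\<lambda>m1 m2 i j. L m1 m2 (unitvec i) (unitvec j))"
  have form: "ip UNIV u (opapp (\<Lambda> m1 m2) v) = L m1 m2 u v" if "m1 < M1" "m2 < M2" for m1 m2 u v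
    unfolding \<Lambda>_def by (rule form_eq_opapp[OF L[OF that]])
  show ?thesis
  proof (rule that[of \<Lambda>])
    show "psd (\<Lambda> m1 m2)" if "m1 < M1" "m2 < M2" for m1 m2
      using L[OF that] by (simp add: psd_iff_form form[OF that])
    show "(\<Sum>m1<M1. \<Sum>m2<M2. \<Lambda> m1 m2 i j) = idop i j" for i j
      by (simp add: \<Lambda>_def tot ip_unitvec_left) (simp add: unitvec_def idop_def)
    fix m1 m2 and \<rho> :: "'z op"
    assume m: "m1 < M1" "m2 < M2" and \<rho>: "density \<rho>"
    obtain n u where u: "\<forall>i j. \<rho> i j = (\<Sum>k<(n::nat). u k i * cnj (u k j))"
      by (rule psd_gram[OF conjunct1[OF \<rho>[unfolded density_def]]])
    have tr: "Tr X \<rho> = (\<Sum>l<n. Re (ip UNIV (u l) (opapp X (u l))))" for X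
      by (simp add: Tr_def trace_gram[OF u[rule_format]])
    have one: "1 = (\<Sum>l<n. Re (ip UNIV (u l) (u l)))"
    proof -
      have "opmult idop \<rho> = \<rho>"
        by (simp add: fun_eq_iff opmult_def idop_def if_distrib[of "\<lambda>x. x * _"] cong: if_cong)
      then have "Tr idop \<rho> = 1" using \<rho> by (simp add: Tr_def density_def)
      then show ?thesis by (simp add: tr opapp_idop)
    qed
    have "Tr (opminus idop (\<Lambda> m1 m2)) \<rho> = (\<Sum>l<n. Re (ip UNIV (u l) (u l)) - Re (L m1 m2 (u l) (u l)))"
      by (simp add: tr opapp_opminus opapp_idop ip.sesq form[OF m])
    also have "\<dots> \<le> (\<Sum>l<n. 8 * (6 / \<delta>\<^sup>2 * (Re (ip UNIV (u l) (u l)) - Re (ip UNIV (u l) (opapp (T3 m1 m2) (u l))))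
          + 2 * (1 + \<delta>\<^sup>2)\<^sup>2 / \<delta>\<^sup>2 * ((Re (ip UNIV (u l) (u l)) - Re (ip UNIV (u l) (opapp (T1 m1 m2) (u l))))
              + (Re (ip UNIV (u l) (u l)) - Re (ip UNIV (u l) (opapp (T2 m1 m2) (u l)))))
          + (1 + \<delta>\<^sup>2) * ((\<Sum>j\<in>{..<M1} - {m1}. Re (ip UNIV (u l) (opapp (T1 j m2) (u l))))
              + (\<Sum>k\<in>{..<M2} - {m2}. Re (ip UNIV (u l) (opapp (T2 m1 k) (u l))))
              + (\<Sum>j\<in>{..<M1} - {m1}. \<Sum>k\<in>{..<M2} - {m2}. Re (ip UNIV (u l) (opapp (T3 j k) (u l))))))
        + 4 * \<delta>\<^sup>2 * Re (ip UNIV (u l) (u l)))"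
      by (rule sum_mono) (rule err[OF m])
    also have "\<dots> = 8 * (6 / \<delta>\<^sup>2 * ((\<Sum>l<n. Re (ip UNIV (u l) (u l))) - Tr (T3 m1 m2) \<rho>)
          + 2 * (1 + \<delta>\<^sup>2)\<^sup>2 / \<delta>\<^sup>2 * (((\<Sum>l<n. Re (ip UNIV (u l) (u l))) - Tr (T1 m1 m2) \<rho>)
              + ((\<Sum>l<n. Re (ip UNIV (u l) (u l))) - Tr (T2 m1 m2) \<rho>))
          + (1 + \<delta>\<^sup>2) * ((\<Sum>j\<in>{..<M1} - {m1}. Tr (T1 j m2) \<rho>)
              + (\<Sum>k\<in>{..<M2} - {m2}. Tr (T2 m1 k) \<rho>)
              + (\<Sum>j\<in>{..<M1} - {m1}. \<Sum>k\<in>{..<M2} - {m2}. Tr (T3 j k) \<rho>)))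
        + 4 * \<delta>\<^sup>2 * (\<Sum>l<n. Re (ip UNIV (u l) (u l)))"
    proof -
      have sw: "(\<Sum>j\<in>A. \<Sum>l<n. f j l) = (\<Sum>l<n. \<Sum>j\<in>A. f j l)" for A and f :: "nat \<Rightarrow> nat \<Rightarrow> real"
        by (rule sum.swap)
      show ?thesis
        unfolding tr sw sum_distrib_left sum.distrib[symmetric] sum_subtractf[symmetric] ..
    qed
    finally show "Tr (opminus idop (\<Lambda> m1 m2)) \<rho>
      \<le> 8 * (6 / \<delta>\<^sup>2 * (1 - Tr (T3 m1 m2) \<rho>)
          + 2 * (1 + \<delta>\<^sup>2)\<^sup>2 / \<delta>\<^sup>2 * ((1 - Tr (T1 m1 m2) \<rho>) + (1 - Tr (T2 m1 m2) \<rho>))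
          + (1 + \<delta>\<^sup>2) * ((\<Sum>j\<in>{..<M1} - {m1}. Tr (T1 j m2) \<rho>)
              + (\<Sum>k\<in>{..<M2} - {m2}. Tr (T2 m1 k) \<rho>)
              + (\<Sum>j\<in>{..<M1} - {m1}. \<Sum>k\<in>{..<M2} - {m2}. Tr (T3 j k) \<rho>)))
        + 4 * \<delta>\<^sup>2"
      unfolding one[symmetric] by simp
  qed
qed

section \<open>Random codebooks\<close>

text \<open>The expectation over a codebook of \<open>M\<close> independent letters with
  distribution \<open>p\<close>. Extensional functions make the set of codebooks finite.\<close>

definition avg :: "('x::finite \<Rightarrow> real) \<Rightarrow> nat \<Rightarrow> ((nat \<Rightarrow> 'x) \<Rightarrow> real) \<Rightarrow> real" where
  "avg p M \<phi> = (\<Sum>f\<in>PiE {..<M} (\<lambda>_. UNIV). (\<Prod>m<M. p (f m)) * \<phi> f)"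

lemma avg_add: "avg p M (\<lambda>f. \<phi> f + \<psi> f) = avg p M \<phi> + avg p M \<psi>"
  by (simp add: avg_def distrib_left sum.distrib)

lemma avg_cmult: "avg p M (\<lambda>f. c * \<phi> f) = c * avg p M \<phi>"
  by (simp add: avg_def sum_distrib_left mult_ac)

lemma avg_sum: "avg p M (\<lambda>f. \<Sum>k\<in>K. \<phi> k f) = (\<Sum>k\<in>K. avg p M (\<phi> k))"
  by (simp add: avg_def sum_distrib_left) (rule sum.swap)

lemma avg_prod: "avg p M (\<lambda>f. \<Prod>m<M. \<chi> m (f m)) = (\<Prod>m<M. \<Sum>x\<in>UNIV. p x * \<chi> m x)"
  unfolding avg_def
  by (subst prod_sum_PiE) (simp_all add: prod.distrib)

text \<open>Two distinct codewords are independent. The function is expanded in products of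
  indicators, for which the expectation factorises over the positions.\<close>

lemma avg_pair:
  assumes p: "(\<Sum>x\<in>UNIV. p x) = 1" and jm: "j < M" "m < M" "j \<noteq> m"
  shows "avg p M (\<lambda>f. \<phi> (f j) (f m)) = (\<Sum>x'\<in>UNIV. \<Sum>x\<in>UNIV. p x' * p x * \<phi> x' x)"
proof -
  have ind: "avg p M (\<lambda>f. (if f j = s then 1 else 0) * (if f m = t then 1 else 0)) = p s * p t" for s t
  proof -
    define \<chi> :: "nat \<Rightarrow> 'a \<Rightarrow> real" where "\<chi> = (\<lambda>i x. if i = j then (if x = s then 1 else 0)
        else if i = m then (if x = t then 1 else 0) else 1)"
    have split: "(\<Prod>i<M. g i) = g j * g m * (\<Prod>i\<in>{..<M} - {j} - {m}. g i)" for g :: "nat \<Rightarrow> real"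
      using jm by (subst prod.remove[of _ j], simp, simp, subst prod.remove[of _ m]) auto
    have "(\<lambda>f. (if f j = s then 1 else 0) * (if f m = t then 1 else 0)) = (\<lambda>f. \<Prod>i<M. \<chi> i (f i))"
      unfolding split using jm by (auto simp: \<chi>_def fun_eq_iff)
    then have "avg p M (\<lambda>f. (if f j = s then 1 else 0) * (if f m = t then 1 else 0))
        = (\<Prod>i<M. \<Sum>x\<in>UNIV. p x * \<chi> i x)"
      by (simp only: avg_prod)
    also have "\<dots> = p s * p t"
      unfolding split using jm p by (simp add: \<chi>_def if_distrib[of "\<lambda>x. _ * x"] cong: if_cong)
    finally show ?thesis .
  qed
  have "\<phi> (f j) (f m) = (\<Sum>s\<in>UNIV. \<Sum>t\<in>UNIV. \<phi> s t * ((if f j = s then 1 else 0) * (if f m = t then 1 else 0)))"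
    for f :: "nat \<Rightarrow> 'a"
    by (simp add: if_distrib[of "\<lambda>x. _ * x"] if_distrib[of "\<lambda>x. x * _"] cong: if_cong)
  then have "avg p M (\<lambda>f. \<phi> (f j) (f m))
      = (\<Sum>s\<in>UNIV. \<Sum>t\<in>UNIV. \<phi> s t * avg p M (\<lambda>f. (if f j = s then 1 else 0) * (if f m = t then 1 else 0)))"
    by (simp only: avg_sum avg_cmult)
  then show ?thesis by (simp add: ind mult_ac)
qed

lemma avg_single:
  assumes p: "(\<Sum>x\<in>UNIV. p x) = 1" and m: "m < M"
  shows "avg p M (\<lambda>f. \<phi> (f m)) = (\<Sum>x\<in>UNIV. p x * \<phi> x)"
proof -
  define \<chi> where "\<chi> = (\<lambda>i x. if i = m then \<phi> x else 1)"
  have split: "(\<Prod>i<M. g i) = g m * (\<Prod>i\<in>{..<M} - {m}. g i)" for g :: "nat \<Rightarrow> real"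
    using m by (subst prod.remove[of _ m]) auto
  have "(\<lambda>f. \<phi> (f m)) = (\<lambda>f. \<Prod>i<M. \<chi> i (f i))"
    unfolding split by (auto simp: \<chi>_def fun_eq_iff)
  then have "avg p M (\<lambda>f. \<phi> (f m)) = (\<Prod>i<M. \<Sum>x\<in>UNIV. p x * \<chi> i x)"
    by (simp only: avg_prod)
  then show ?thesis unfolding split using p by (simp add: \<chi>_def)
qed

text \<open>If every codebook exceeded \<open>c\<close>, the nonnegative terms
  \<open>w f * (\<phi> f - c)\<close> would have a sum that is at most 0; all weights would then
  vanish, although they add up to 1.\<close>

lemma avg_exists:
  assumes p: "\<forall>x. p x \<ge> 0" "(\<Sum>x\<in>UNIV. p x) = 1" and le: "avg p M \<phi> \<le> c"
  shows "\<exists>f. \<phi> f \<le> c"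
proof (rule ccontr)
  assume "\<not> ?thesis"
  then have gt: "\<phi> f > c" for f by (simp add: not_le)
  define F where "F = PiE {..<M} (\<lambda>_. UNIV :: 'a set)"
  have F: "finite F" by (simp add: F_def finite_PiE)
  define w where "w = (\<lambda>f. \<Prod>m<M. p (f m))"
  have w: "w f \<ge> 0" for f using p by (simp add: w_def prod_nonneg)
  have one: "(\<Sum>f\<in>F. w f) = 1"
    using prod_sum_PiE[of "{..<M}" "\<lambda>_. UNIV" "\<lambda>_. p"] p by (simp add: F_def w_def)
  have "(\<Sum>f\<in>F. w f * (\<phi> f - c)) = avg p M \<phi> - c"
    using one by (simp add: avg_def F_def w_def right_diff_distrib sum_subtractf flip: sum_distrib_right)
  moreover have nn: "w f * (\<phi> f - c) \<ge> 0" for f using w[of f] gt[of f] by simp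
  ultimately have "(\<Sum>f\<in>F. w f * (\<phi> f - c)) = 0"
    using le sum_nonneg[of F "\<lambda>f. w f * (\<phi> f - c)"] by force
  then have "\<forall>f\<in>F. w f * (\<phi> f - c) = 0"
    using F nn by (subst (asm) sum_nonneg_eq_0_iff) auto
  then have "\<forall>f\<in>F. w f = 0" using gt by (metis less_irrefl mult_eq_0_iff right_minus_eq)
  then show False using one by simp
qed

text \<open>Primed letters are those of a competing codeword. They are independent of the
  transmitted ones, so each kind of competitor has the same expectation for all message pairs, and
  there are at most \<open>M1\<close>, \<open>M2\<close> and \<open>M1 * M2\<close> competitors of
  the three kinds. Each kind contributes at most \<open>e\<close>.\<close>

lemma random_codebook:
  fixes p :: "'x::finite \<Rightarrow> real" and q :: "'y::finite \<Rightarrow> real"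
    and g1 g2 g3
  assumes p: "\<forall>x. p x \<ge> 0" "(\<Sum>x\<in>UNIV. p x) = 1" and q: "\<forall>y. q y \<ge> 0" "(\<Sum>y\<in>UNIV. q y) = 1"
    and M: "M1 > 0" "M2 > 0" and K: "K \<ge> 0"
    and nn: "\<And>x' x y. g1 x' x y \<ge> 0" "\<And>x y' y. g2 x y' y \<ge> 0" "\<And>x' y' x y. g3 x' y' x y \<ge> 0"
    and H: "(\<Sum>x\<in>UNIV. p x * (\<Sum>y\<in>UNIV. q y * h x y)) \<le> H0"
    and A1: "real M1 * (\<Sum>x'\<in>UNIV. \<Sum>x\<in>UNIV. p x' * p x * (\<Sum>y\<in>UNIV. q y * g1 x' x y)) \<le> e"
    and A2: "real M2 * (\<Sum>x\<in>UNIV. p x * (\<Sum>y'\<in>UNIV. \<Sum>y\<in>UNIV. q y' * q y * g2 x y' y)) \<le> e"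
    and A3: "real M1 * real M2 * (\<Sum>x'\<in>UNIV. \<Sum>x\<in>UNIV. p x' * p x *
        (\<Sum>y'\<in>UNIV. \<Sum>y\<in>UNIV. q y' * q y * g3 x' y' x y)) \<le> e"
  shows "\<exists>f g. 1 / (real M1 * real M2) * (\<Sum>m1<M1. \<Sum>m2<M2. h (f m1) (g m2)
      + K * ((\<Sum>j\<in>{..<M1} - {m1}. g1 (f j) (f m1) (g m2)) + (\<Sum>k\<in>{..<M2} - {m2}. g2 (f m1) (g k) (g m2))
        + (\<Sum>j\<in>{..<M1} - {m1}. \<Sum>k\<in>{..<M2} - {m2}. g3 (f j) (g k) (f m1) (g m2))))
    \<le> H0 + 3 * K * e" (is "\<exists>f g. ?F f g \<le> _")
proof -
  define E where "E = (\<lambda>\<phi>. avg p M1 (\<lambda>f. avg q M2 (\<phi> f)))"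
  define S1 where "S1 = (\<Sum>x'\<in>UNIV. \<Sum>x\<in>UNIV. p x' * p x * (\<Sum>y\<in>UNIV. q y * g1 x' x y))"
  define S2 where "S2 = (\<Sum>x\<in>UNIV. p x * (\<Sum>y'\<in>UNIV. \<Sum>y\<in>UNIV. q y' * q y * g2 x y' y))"
  define S3 where "S3 = (\<Sum>x'\<in>UNIV. \<Sum>x\<in>UNIV. p x' * p x *
        (\<Sum>y'\<in>UNIV. \<Sum>y\<in>UNIV. q y' * q y * g3 x' y' x y))"
  have S: "S1 \<ge> 0" "S2 \<ge> 0" "S3 \<ge> 0"
    unfolding S1_def S2_def S3_def using p q nn
    by (auto intro!: sum_nonneg mult_nonneg_nonneg)
  have e0: "E (\<lambda>f g. h (f m1) (g m2)) \<le> H0" if "m1 < M1" "m2 < M2" for m1 m2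
    unfolding E_def avg_single[OF q(2) that(2), where \<phi> = "h _"]
    using H avg_single[OF p(2) that(1), where \<phi> = "\<lambda>x. \<Sum>y\<in>UNIV. q y * h x y"] by simp
  have e1: "E (\<lambda>f g. g1 (f j) (f m1) (g m2)) = S1" if "m1 < M1" "m2 < M2" "j < M1" "j \<noteq> m1" for m1 m2 j
    unfolding E_def S1_def avg_single[OF q(2) that(2), where \<phi> = "g1 _ _"]
    by (rule avg_pair[OF p(2) that(3,1,4), where \<phi> = "\<lambda>x' x. \<Sum>y\<in>UNIV. q y * g1 x' x y"])
  have e2: "E (\<lambda>f g. g2 (f m1) (g k) (g m2)) = S2" if "m1 < M1" "m2 < M2" "k < M2" "k \<noteq> m2" for m1 m2 k
    unfolding E_def S2_def avg_pair[OF q(2) that(3,2,4), where \<phi> = "g2 _"]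
    by (rule avg_single[OF p(2) that(1), where \<phi> = "\<lambda>x. \<Sum>y'\<in>UNIV. \<Sum>y\<in>UNIV. q y' * q y * g2 x y' y"])
  have e3: "E (\<lambda>f g. g3 (f j) (g k) (f m1) (g m2)) = S3"
    if "m1 < M1" "m2 < M2" "j < M1" "j \<noteq> m1" "k < M2" "k \<noteq> m2" for m1 m2 j k
    unfolding E_def S3_def avg_pair[OF q(2) that(5,2,6), where \<phi> = "\<lambda>y' y. g3 _ y' _ y"]
    by (rule avg_pair[OF p(2) that(3,1,4), where \<phi> = "\<lambda>x' x. \<Sum>y'\<in>UNIV. \<Sum>y\<in>UNIV. q y' * q y * g3 x' y' x y"])
  have E_add: "E (\<lambda>f g. \<phi> f g + \<psi> f g) = E \<phi> + E \<psi>" for \<phi> \<psi> by (simp add: E_def avg_add)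
  have E_cmult: "E (\<lambda>f g. c * \<phi> f g) = c * E \<phi>" for c \<phi> by (simp add: E_def avg_cmult)
  have E_sum: "E (\<lambda>f g. \<Sum>k\<in>I. \<phi> k f g) = (\<Sum>k\<in>I. E (\<phi> k))" for I :: "nat set" and \<phi>
    by (simp add: E_def avg_sum)
  have bnd: "E (\<lambda>f g. h (f m1) (g m2)
      + K * ((\<Sum>j\<in>{..<M1} - {m1}. g1 (f j) (f m1) (g m2)) + (\<Sum>k\<in>{..<M2} - {m2}. g2 (f m1) (g k) (g m2))
        + (\<Sum>j\<in>{..<M1} - {m1}. \<Sum>k\<in>{..<M2} - {m2}. g3 (f j) (g k) (f m1) (g m2)))) \<le> H0 + 3 * K * e"
    if m: "m1 < M1" "m2 < M2" for m1 m2
  proof -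
    have 1: "(\<Sum>j\<in>{..<M1} - {m1}. E (\<lambda>f g. g1 (f j) (f m1) (g m2))) \<le> e"
    proof -
      have "(\<Sum>j\<in>{..<M1} - {m1}. E (\<lambda>f g. g1 (f j) (f m1) (g m2))) = (\<Sum>j\<in>{..<M1} - {m1}. S1)"
        by (rule sum.cong) (use e1 m in auto)
      also have "\<dots> \<le> real M1 * S1" using m S by (simp add: mult_right_mono)
      finally show ?thesis using A1 by (simp add: S1_def)
    qed
    have 2: "(\<Sum>k\<in>{..<M2} - {m2}. E (\<lambda>f g. g2 (f m1) (g k) (g m2))) \<le> e"
    proof -
      have "(\<Sum>k\<in>{..<M2} - {m2}. E (\<lambda>f g. g2 (f m1) (g k) (g m2))) = (\<Sum>k\<in>{..<M2} - {m2}. S2)"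
        by (rule sum.cong) (use e2 m in auto)
      also have "\<dots> \<le> real M2 * S2" using m S by (simp add: mult_right_mono)
      finally show ?thesis using A2 by (simp add: S2_def)
    qed
    have 3: "(\<Sum>j\<in>{..<M1} - {m1}. \<Sum>k\<in>{..<M2} - {m2}. E (\<lambda>f g. g3 (f j) (g k) (f m1) (g m2))) \<le> e"
    proof -
      have "(\<Sum>j\<in>{..<M1} - {m1}. \<Sum>k\<in>{..<M2} - {m2}. E (\<lambda>f g. g3 (f j) (g k) (f m1) (g m2)))
          = (\<Sum>j\<in>{..<M1} - {m1}. \<Sum>k\<in>{..<M2} - {m2}. S3)"
        by (intro sum.cong refl) (use e3 m in auto)
      also have "\<dots> = real (M1 - 1) * (real (M2 - 1) * S3)" using m by simp
      also have "\<dots> \<le> real M1 * (real M2 * S3)" using S by (intro mult_mono) auto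
      finally show ?thesis using A3 by (simp add: S3_def mult.assoc)
    qed
    have "E (\<lambda>f g. h (f m1) (g m2)
      + K * ((\<Sum>j\<in>{..<M1} - {m1}. g1 (f j) (f m1) (g m2)) + (\<Sum>k\<in>{..<M2} - {m2}. g2 (f m1) (g k) (g m2))
        + (\<Sum>j\<in>{..<M1} - {m1}. \<Sum>k\<in>{..<M2} - {m2}. g3 (f j) (g k) (f m1) (g m2))))
      = E (\<lambda>f g. h (f m1) (g m2))
      + K * ((\<Sum>j\<in>{..<M1} - {m1}. E (\<lambda>f g. g1 (f j) (f m1) (g m2)))
        + (\<Sum>k\<in>{..<M2} - {m2}. E (\<lambda>f g. g2 (f m1) (g k) (g m2)))
        + (\<Sum>j\<in>{..<M1} - {m1}. \<Sum>k\<in>{..<M2} - {m2}. E (\<lambda>f g. g3 (f j) (g k) (f m1) (g m2))))"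
      by (simp only: E_add E_cmult E_sum)
    also have "\<dots> \<le> H0 + K * (e + e + e)"
      using e0[OF m] 1 2 3 K by (intro add_mono mult_left_mono) auto
    finally show ?thesis by simp
  qed
  have "E ?F \<le> H0 + 3 * K * e"
  proof -
    have "E ?F \<le> 1 / (real M1 * real M2) * (\<Sum>m1<M1. \<Sum>m2<M2. H0 + 3 * K * e)"
      unfolding E_cmult E_sum using bnd by (intro mult_left_mono sum_mono) auto
    also have "\<dots> = H0 + 3 * K * e" using M by simp
    finally show ?thesis .
  qed
  \<comment> \<open>The first codebook is fixed by its average over the second, and then the second
    one is chosen.\<close>
  then obtain f where "avg q M2 (?F f) \<le> H0 + 3 * K * e"
    unfolding E_def using avg_exists[OF p] by blast
  then show ?thesis using avg_exists[OF q] by blast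
qed

section \<open>Tests for classical-quantum states\<close>

text \<open>The 1 subtracted from the rate puts \<open>log 2 (M / \<epsilon>)\<close> strictly below
  the supremum, so some test exceeds it; this includes an infinite supremum. Exceeding it means
  error below \<open>\<epsilon> / M\<close>.\<close>

lemma DH_test:
  fixes \<alpha> \<beta> :: "('i::finite) op"
  assumes le: "ereal (log 2 M) \<le> DH \<epsilon> \<alpha> \<beta> - ereal (1 + log 2 (1 / \<epsilon>))" and \<epsilon>: "0 < \<epsilon>" and M: "0 < M"
  obtains T where "psd T" "psd (opminus idop T)" "1 - \<epsilon> \<le> Tr T \<alpha>" "M * Tr T \<beta> \<le> \<epsilon>"
proof -
  define c where "c = log 2 (M / \<epsilon>)"
  have c: "c = log 2 M + log 2 (1 / \<epsilon>)"
    using \<epsilon> M by (simp add: c_def log_divide)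
  have "ereal c < DH \<epsilon> \<alpha> \<beta>"
    using le unfolding c by (cases "DH \<epsilon> \<alpha> \<beta>") auto
  then obtain T where T: "psd T" "psd (opminus idop T)" "1 - \<epsilon> \<le> Tr T \<alpha>"
    and gt: "ereal c < (if Tr T \<beta> > 0 then ereal (- log 2 (Tr T \<beta>)) else PInfty)"
    unfolding DH_def less_SUP_iff Tr_def by auto
  have "M * Tr T \<beta> \<le> \<epsilon>"
  proof (cases "Tr T \<beta> > 0")
    case True
    then have "log 2 (Tr T \<beta>) < - c" using gt by simp
    also have "- c = log 2 (\<epsilon> / M)" using \<epsilon> M by (simp add: c_def log_divide)
    finally have "Tr T \<beta> < \<epsilon> / M" using True \<epsilon> M by (subst (asm) log_less_cancel_iff) auto
    then show ?thesis using M by (simp add: field_simps)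
  next
    case False
    then have "M * Tr T \<beta> \<le> 0" using M by (simp add: mult_le_0_iff)
    then show ?thesis using \<epsilon> by simp
  qed
  then show ?thesis using T that by blast
qed

text \<open>A vector on the block is extended by zero along the embedding \<open>e\<close>.\<close>

lemma psd_block:
  fixes A :: "('w::finite) op" and e :: "'z::finite \<Rightarrow> 'w"
  assumes "psd A" "inj e"
  shows "psd (\<lambda>i j. A (e i) (e j))"
  unfolding psd_def psd_on_def
proof (rule allI)
  fix v :: "'z \<Rightarrow> complex"
  define w where "w = (\<lambda>k. if k \<in> range e then v (inv e k) else 0)"
  have w: "w (e i) = v i" for i using assms(2) by (simp add: w_def)
  have w0: "w k = 0" if "k \<notin> range e" for k using that by (simp add: w_def)
  have red: "(\<Sum>k\<in>UNIV. g k) = (\<Sum>i\<in>UNIV. g (e i))" if "\<And>k. k \<notin> range e \<Longrightarrow> g k = 0" for g :: "'w \<Rightarrow> complex"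
  proof -
    have "(\<Sum>k\<in>UNIV. g k) = (\<Sum>k\<in>range e. g k)"
      by (rule sum.mono_neutral_right) (use that in auto)
    then show ?thesis using assms(2) by (simp add: sum.reindex)
  qed
  have "(\<Sum>k\<in>UNIV. \<Sum>l\<in>UNIV. cnj (w k) * A k l * w l)
      = (\<Sum>i\<in>UNIV. \<Sum>j\<in>UNIV. cnj (v i) * A (e i) (e j) * v j)"
    by (subst red, simp add: w0, subst red, simp add: w0, simp add: w)
  then show "(\<Sum>i\<in>UNIV. \<Sum>j\<in>UNIV. cnj (v i) * A (e i) (e j) * v j) \<in> \<real> \<and>
      0 \<le> Re (\<Sum>i\<in>UNIV. \<Sum>j\<in>UNIV. cnj (v i) * A (e i) (e j) * v j)"
    using \<open>psd A\<close>[unfolded psd_def psd_on_def, rule_format, of w] by simp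
qed

lemma psd_block_compl:
  fixes A :: "('w::finite) op" and e :: "'z::finite \<Rightarrow> 'w"
  assumes "psd (opminus idop A)" "inj e"
  shows "psd (opminus idop (\<lambda>i j. A (e i) (e j)))"
proof -
  have "opminus idop (\<lambda>i j. A (e i) (e j)) = (\<lambda>i j. opminus idop A (e i) (e j))"
    using assms(2) by (auto simp: opminus_def idop_def fun_eq_iff inj_eq)
  then show ?thesis using psd_block[OF assms] by simp
qed

lemma Tr_nonneg:
  assumes "psd X" "psd A"
  shows "Tr X A \<ge> 0"
proof -
  obtain n u where u: "\<forall>i j. A i j = (\<Sum>k<(n::nat). u k i * cnj (u k j))"
    by (rule psd_gram[OF assms(2)])
  show ?thesis
    using psd_form.nonneg[OF assms(1)[unfolded psd_iff_form]]
    by (simp add: Tr_def trace_gram[OF u[rule_format]] sum_nonneg)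
qed

lemma Tr_sum: "Tr X (\<lambda>i j. \<Sum>x\<in>I. complex_of_real (c x) * A x i j) = (\<Sum>x\<in>I. c x * Tr X (A x))"
proof -
  have "trace (opmult X (\<lambda>i j. \<Sum>x\<in>I. complex_of_real (c x) * A x i j))
      = (\<Sum>i\<in>UNIV. \<Sum>k\<in>UNIV. \<Sum>x\<in>I. complex_of_real (c x) * (X i k * A x k i))"
    by (simp add: trace_def opmult_def sum_distrib_left mult_ac)
  also have "\<dots> = (\<Sum>x\<in>I. \<Sum>i\<in>UNIV. \<Sum>k\<in>UNIV. complex_of_real (c x) * (X i k * A x k i))"
    by (subst sum.swap[of _ I]) (simp add: sum.swap[of _ I])
  also have "\<dots> = (\<Sum>x\<in>I. complex_of_real (c x) * trace (opmult X (A x)))"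
    by (simp add: trace_def opmult_def sum_distrib_left)
  finally show ?thesis by (simp add: Tr_def)
qed

text \<open>The classical-quantum state with register \<open>k\<close>, written as a block-diagonal
  matrix. The variant \<open>cqq\<close> has two registers, nested as in the index type of the
  channel state.\<close>

definition cq :: "('k \<Rightarrow> real) \<Rightarrow> ('k \<Rightarrow> 'z op) \<Rightarrow> ('k \<times> 'z) op" where
  "cq w \<tau> = (\<lambda>(k, z) (k', z'). if k = k' then complex_of_real (w k) * \<tau> k z z' else 0)"

definition cqq :: "('x \<Rightarrow> real) \<Rightarrow> ('y \<Rightarrow> real) \<Rightarrow> ('x \<Rightarrow> 'y \<Rightarrow> 'z op) \<Rightarrow> ('x \<times> 'y \<times> 'z) op" where
  "cqq p q \<tau> = (\<lambda>(x, y, z) (x', y', z').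
     if x = x' \<and> y = y' then complex_of_real (p x * q y) * \<tau> x y z z' else 0)"

lemma sum_if_const: "(\<Sum>y\<in>A. if c then f y else 0) = (if c then \<Sum>y\<in>A. f y else (0::complex))"
  by simp

text \<open>Only the diagonal blocks of a test meet a block-diagonal state, so a joint test amounts
  to one test per letter.\<close>

lemma Tr_cq:
  fixes T :: "('k::finite \<times> 'z::finite) op"
  shows "Tr T (cq w \<tau>) = (\<Sum>k\<in>UNIV. w k * Tr (\<lambda>z z'. T (k, z) (k, z')) (\<tau> k))"
proof -
  have "(\<Sum>l\<in>UNIV. T (k, z) l * cq w \<tau> l (k, z))
      = (\<Sum>z'\<in>UNIV. complex_of_real (w k) * (T (k, z) (k, z') * \<tau> k z' z))" for k z
    unfolding UNIV_Times_UNIV[symmetric] sum.cartesian_product'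
    by (simp add: cq_def if_distrib[of "\<lambda>x. _ * x"] sum_if_const mult_ac cong: if_cong)
  then have "trace (opmult T (cq w \<tau>))
      = (\<Sum>k\<in>UNIV. complex_of_real (w k) * trace (opmult (\<lambda>z z'. T (k, z) (k, z')) (\<tau> k)))"
    unfolding trace_def opmult_def UNIV_Times_UNIV[symmetric] sum.cartesian_product'
    by (simp add: sum_distrib_left)
  then show ?thesis by (simp add: Tr_def)
qed

lemma Tr_cqq:
  fixes T :: "('x::finite \<times> 'y::finite \<times> 'z::finite) op"
  shows "Tr T (cqq p q \<tau>)
    = (\<Sum>x\<in>UNIV. \<Sum>y\<in>UNIV. p x * q y * Tr (\<lambda>z z'. T (x, y, z) (x, y, z')) (\<tau> x y))"
proof -
  have "(\<Sum>l\<in>UNIV. T (x, y, z) l * cqq p q \<tau> l (x, y, z))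
      = (\<Sum>z'\<in>UNIV. complex_of_real (p x * q y) * (T (x, y, z) (x, y, z') * \<tau> x y z' z))" for x y z
    unfolding UNIV_Times_UNIV[symmetric] sum.cartesian_product'
    by (simp add: cqq_def if_distrib[of "\<lambda>x. _ * x"] if_if_eq_conj[symmetric] sum_if_const mult_ac
        cong: if_cong)
  then have "trace (opmult T (cqq p q \<tau>)) = (\<Sum>x\<in>UNIV. \<Sum>y\<in>UNIV.
      complex_of_real (p x * q y) * trace (opmult (\<lambda>z z'. T (x, y, z) (x, y, z')) (\<tau> x y)))"
    unfolding trace_def opmult_def UNIV_Times_UNIV[symmetric] sum.cartesian_product'
    by (simp add: sum_distrib_left)
  then show ?thesis by (simp add: Tr_def)
qed

text \<open>The first marginal is diagonal with entries \<open>p\<close>, and the second keeps its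
  register \<open>y\<close>. Their product is again block diagonal, with a signal averaged over an
  independent copy of the first letter.\<close>

lemma cqq_marginal_product:
  fixes \<rho> :: "'x::finite \<Rightarrow> 'y::finite \<Rightarrow> ('z::finite) op"
  assumes "\<And>x y. trace (\<rho> x y) = 1" "(\<Sum>y\<in>UNIV. q y) = 1"
  shows "tensor (ptrace2 (cqq p q \<rho>)) (ptrace1 (cqq p q \<rho>))
    = cqq p q (\<lambda>x y z z'. \<Sum>x'\<in>UNIV. complex_of_real (p x') * \<rho> x' y z z')"
proof -
  have "(\<Sum>y\<in>UNIV. complex_of_real (q y)) = 1" using assms(2) by (metis of_real_sum of_real_1)
  then have "(\<Sum>y\<in>UNIV. \<Sum>z\<in>UNIV. complex_of_real (p x) * complex_of_real (q y) * \<rho> x y z z) = complex_of_real (p x)" for x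
    using assms(1) by (simp add: trace_def flip: sum_distrib_left)
  then have 2: "ptrace2 (cqq p q \<rho>) x x' = (if x = x' then complex_of_real (p x) else 0)" for x x'
    unfolding ptrace2_def UNIV_Times_UNIV[symmetric] sum.cartesian_product' by (simp add: cqq_def)
  have 1: "ptrace1 (cqq p q \<rho>) (y, z) (y', z')
      = (if y = y' then complex_of_real (q y) * (\<Sum>x'\<in>UNIV. complex_of_real (p x') * \<rho> x' y z z') else 0)" for y z y' z'
    by (simp add: ptrace1_def cqq_def sum_distrib_left mult_ac)
  show ?thesis
    by (auto simp: tensor_def fun_eq_iff 1 2) (auto simp: cqq_def)
qed

lemma cq_marginal_product:
  fixes \<rho> :: "'k::finite \<Rightarrow> ('z::finite) op"
  assumes "\<And>k. trace (\<rho> k) = 1"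
  shows "tensor (ptrace2 (cq w \<rho>)) (ptrace1 (cq w \<rho>))
    = cq w (\<lambda>k z z'. \<Sum>k'\<in>UNIV. complex_of_real (w k') * \<rho> k' z z')"
proof -
  have "(\<Sum>z\<in>UNIV. complex_of_real (w k) * \<rho> k z z) = complex_of_real (w k)" for k
    using assms by (simp add: trace_def flip: sum_distrib_left)
  then have 2: "ptrace2 (cq w \<rho>) k k' = (if k = k' then complex_of_real (w k) else 0)" for k k'
    by (simp add: ptrace2_def cq_def)
  have 1: "ptrace1 (cq w \<rho>) z z' = (\<Sum>k'\<in>UNIV. complex_of_real (w k') * \<rho> k' z z')" for z z'
    by (simp add: ptrace1_def cq_def)
  show ?thesis
    by (auto simp: tensor_def fun_eq_iff 1 2) (auto simp: cq_def)
qed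

text \<open>The diagonal blocks of an optimal-order test. In the last bound the tested letter
  \<open>x'\<close> is independent of the transmitted \<open>x\<close>: this is the error against a
  competitor that is wrong in the first message only.\<close>

lemma cqq_test:
  fixes \<rho> :: "'x::finite \<Rightarrow> 'y::finite \<Rightarrow> ('z::finite) op"
  assumes tr: "\<And>x y. trace (\<rho> x y) = 1" and q: "(\<Sum>y\<in>UNIV. q y) = 1"
    and le: "ereal (log 2 M) \<le> DH \<epsilon> (cqq p q \<rho>) (tensor (ptrace2 (cqq p q \<rho>)) (ptrace1 (cqq p q \<rho>)))
        - ereal (1 + log 2 (1 / \<epsilon>))"
    and \<epsilon>: "0 < \<epsilon>" and M: "0 < M"
  obtains T where "\<forall>x y. psd (T x y) \<and> psd (opminus idop (T x y))"
    "1 - \<epsilon> \<le> (\<Sum>x\<in>UNIV. \<Sum>y\<in>UNIV. p x * q y * Tr (T x y) (\<rho> x y))"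
    "M * (\<Sum>x'\<in>UNIV. \<Sum>y\<in>UNIV. p x' * q y * (\<Sum>x\<in>UNIV. p x * Tr (T x' y) (\<rho> x y))) \<le> \<epsilon>"
proof -
  obtain T where T: "psd T" "psd (opminus idop T)" and 1: "1 - \<epsilon> \<le> Tr T (cqq p q \<rho>)"
    and 2: "M * Tr T (tensor (ptrace2 (cqq p q \<rho>)) (ptrace1 (cqq p q \<rho>))) \<le> \<epsilon>"
    using DH_test[OF le \<epsilon> M] by blast
  show ?thesis
  proof (rule that[of "\<lambda>x y z z'. T (x, y, z) (x, y, z')"])
    show "\<forall>x y. psd (\<lambda>z z'. T (x, y, z) (x, y, z')) \<and> psd (opminus idop (\<lambda>z z'. T (x, y, z) (x, y, z')))"
      by (intro allI conjI psd_block[OF T(1)] psd_block_compl[OF T(2)]) (simp_all add: inj_def)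
    show "1 - \<epsilon> \<le> (\<Sum>x\<in>UNIV. \<Sum>y\<in>UNIV. p x * q y * Tr (\<lambda>z z'. T (x, y, z) (x, y, z')) (\<rho> x y))"
      using 1 by (simp only: Tr_cqq)
    show "M * (\<Sum>x'\<in>UNIV. \<Sum>y\<in>UNIV. p x' * q y
        * (\<Sum>x\<in>UNIV. p x * Tr (\<lambda>z z'. T (x', y, z) (x', y, z')) (\<rho> x y))) \<le> \<epsilon>"
      using 2 by (simp only: cqq_marginal_product[OF tr q] Tr_cqq Tr_sum)
  qed
qed

lemma cq_test:
  fixes \<rho> :: "'k::finite \<Rightarrow> ('z::finite) op"
  assumes tr: "\<And>k. trace (\<rho> k) = 1"
    and le: "ereal (log 2 M) \<le> DH \<epsilon> (cq w \<rho>) (tensor (ptrace2 (cq w \<rho>)) (ptrace1 (cq w \<rho>)))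
        - ereal (1 + log 2 (1 / \<epsilon>))"
    and \<epsilon>: "0 < \<epsilon>" and M: "0 < M"
  obtains T where "\<forall>k. psd (T k) \<and> psd (opminus idop (T k))"
    "1 - \<epsilon> \<le> (\<Sum>k\<in>UNIV. w k * Tr (T k) (\<rho> k))"
    "M * (\<Sum>k'\<in>UNIV. w k' * (\<Sum>k\<in>UNIV. w k * Tr (T k') (\<rho> k))) \<le> \<epsilon>"
proof -
  obtain T where T: "psd T" "psd (opminus idop T)" and 1: "1 - \<epsilon> \<le> Tr T (cq w \<rho>)"
    and 2: "M * Tr T (tensor (ptrace2 (cq w \<rho>)) (ptrace1 (cq w \<rho>))) \<le> \<epsilon>"
    using DH_test[OF le \<epsilon> M] by blast
  show ?thesis
  proof (rule that[of "\<lambda>k z z'. T (k, z) (k, z')"])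
    show "\<forall>k. psd (\<lambda>z z'. T (k, z) (k, z')) \<and> psd (opminus idop (\<lambda>z z'. T (k, z) (k, z')))"
      by (intro allI conjI psd_block[OF T(1)] psd_block_compl[OF T(2)]) (simp_all add: inj_def)
    show "1 - \<epsilon> \<le> (\<Sum>k\<in>UNIV. w k * Tr (\<lambda>z z'. T (k, z) (k, z')) (\<rho> k))"
      using 1 by (simp only: Tr_cq)
    show "M * (\<Sum>k'\<in>UNIV. w k' * (\<Sum>k\<in>UNIV. w k * Tr (\<lambda>z z'. T (k', z) (k', z')) (\<rho> k))) \<le> \<epsilon>"
      using 2 by (simp only: cq_marginal_product[OF tr] Tr_cq Tr_sum)
  qed
qed

section \<open>The coding theorem\<close>

lemma mac_state_eq_cqq: "mac_state p q \<sigma>X \<sigma>Y C = cqq p q (\<lambda>x y. C (tensor (\<sigma>X x) (\<sigma>Y y)))"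
proof (rule ext, rule ext)
  fix a b :: "'a \<times> 'b \<times> 'c"
  obtain x y z x' y' z' where ab: "a = (x, y, z)" "b = (x', y', z')" by (metis prod.exhaust)
  have "mac_state p q \<sigma>X \<sigma>Y C a b = (\<Sum>s\<in>UNIV. \<Sum>t\<in>UNIV. if x = s \<and> x' = s \<and> y = t \<and> y' = t
      then complex_of_real (p x * q y) * C (tensor (\<sigma>X x) (\<sigma>Y y)) z z' else 0)"
    unfolding mac_state_def ab by (intro sum.cong refl) (auto simp: tensor_def proj_def)
  also have "\<dots> = (\<Sum>s\<in>UNIV. if x = s then \<Sum>t\<in>UNIV. if y = t then
      if x = x' \<and> y = y' then complex_of_real (p x * q y) * C (tensor (\<sigma>X x) (\<sigma>Y y)) z z' else 0 else 0 else 0)"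
    by (intro sum.cong refl) (auto intro!: sum.cong sum.neutral)
  also have "\<dots> = cqq p q (\<lambda>x y. C (tensor (\<sigma>X x) (\<sigma>Y y))) a b"
    by (simp add: ab cqq_def)
  finally show "mac_state p q \<sigma>X \<sigma>Y C a b = cqq p q (\<lambda>x y. C (tensor (\<sigma>X x) (\<sigma>Y y))) a b" .
qed

text \<open>Covers error bounds of 1 or more: constant encodings, and a decoder that always
  announces the pair \<open>(0, 0)\<close>.\<close>

lemma trivial_code:
  fixes C :: "('a::finite \<times> 'b::finite) op \<Rightarrow> ('z::finite) op"
  assumes "density \<alpha>" "density \<beta>" "density (C (tensor \<alpha> \<beta>))" "M1 \<ge> 1" "M2 \<ge> 1" "1 \<le> \<eta>"
  shows "\<exists>\<alpha> \<beta> \<Lambda>. mac_code C M1 M2 \<eta> \<alpha> \<beta> \<Lambda>"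
proof -
  define \<Lambda> :: "nat \<Rightarrow> nat \<Rightarrow> 'z op" where
    "\<Lambda> = (\<lambda>m1 m2 i j. if m1 = 0 \<and> m2 = 0 then idop i j else 0)"
  have psd: "psd (idop :: 'z op)" "psd (\<lambda>i j :: 'z. 0)"
    using psd_form_ip[of UNIV] by (simp_all add: psd_iff_form opapp_idop)
      (simp add: opapp_def ip_def psd_form_def)
  have \<Lambda>: "psd (\<Lambda> m1 m2)" for m1 m2
    unfolding \<Lambda>_def using psd by (cases "m1 = 0 \<and> m2 = 0") (simp_all only: if_True if_False simp_thms)
  have "Tr (opminus idop (\<Lambda> m1 m2)) (C (tensor \<alpha> \<beta>)) \<le> 1" for m1 m2
    using Tr_nonneg[OF \<Lambda>[of m1 m2], of "C (tensor \<alpha> \<beta>)"] assms(3)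
    unfolding Tr_diff_idop[OF assms(3)] by (simp add: density_def)
  then have "(\<Sum>m1<M1. \<Sum>m2<M2. Tr (opminus idop (\<Lambda> m1 m2)) (C (tensor \<alpha> \<beta>))) \<le> (\<Sum>m1<M1. \<Sum>m2<M2. 1)"
    by (intro sum_mono)
  then have "1 / (real M1 * real M2) * (\<Sum>m1<M1. \<Sum>m2<M2. Tr (opminus idop (\<Lambda> m1 m2)) (C (tensor \<alpha> \<beta>))) \<le> 1"
    using assms(4,5) by (simp add: divide_le_eq)
  then have "1 / (real M1 * real M2) * (\<Sum>m1<M1. \<Sum>m2<M2. Tr (opminus idop (\<Lambda> m1 m2)) (C (tensor \<alpha> \<beta>))) \<le> \<eta>"
    using assms(6) by linarith
  moreover have "(\<Sum>m1<M1. \<Sum>m2<M2. \<Lambda> m1 m2 i j) = idop i j" for i j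
  proof -
    have "(\<Sum>m1<M1. \<Sum>m2<M2. \<Lambda> m1 m2 i j) = (\<Sum>m1<M1. if m1 = 0 then (\<Sum>m2<M2. if m2 = 0 then idop i j else 0) else 0)"
      by (intro sum.cong refl) (auto simp: \<Lambda>_def intro!: sum.cong)
    then show ?thesis using assms(4,5) by simp
  qed
  ultimately have "mac_code C M1 M2 \<eta> (\<lambda>_. \<alpha>) (\<lambda>_. \<beta>) \<Lambda>"
    using assms(1,2) \<Lambda> unfolding mac_code_def Tr_def by blast
  then show ?thesis by blast
qed

theorem theorem1:
  fixes C :: "('a::finite \<times> 'b::finite) op \<Rightarrow> ('z::finite) op"
    and p :: "'x::finite \<Rightarrow> real" and q :: "'y::finite \<Rightarrow> real"
    and \<sigma>X :: "'x \<Rightarrow> 'a op" and \<sigma>Y :: "'y \<Rightarrow> 'b op"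
    and \<epsilon> :: real and M1 M2 :: nat
  assumes "quantum_channel C"
    and "\<forall>x. density (\<sigma>X x)" and "\<forall>y. density (\<sigma>Y y)"
    and "\<forall>x. p x \<ge> 0" and "(\<Sum>x\<in>UNIV. p x) = 1"
    and "\<forall>y. q y \<ge> 0" and "(\<Sum>y\<in>UNIV. q y) = 1"
    and "0 < \<epsilon>" and "\<epsilon> < 1"
    and "M1 \<ge> 1" and "M2 \<ge> 1"
    and "ereal (log 2 M1) \<le> IH_X_YZ \<epsilon> (mac_state p q \<sigma>X \<sigma>Y C) - ereal (1 + log 2 (1 / \<epsilon>))"
    and "ereal (log 2 M2) \<le> IH_Y_XZ \<epsilon> (mac_state p q \<sigma>X \<sigma>Y C) - ereal (1 + log 2 (1 / \<epsilon>))"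
    and "ereal (log 2 M1 + log 2 M2) \<le> IH_XY_Z \<epsilon> (mac_state p q \<sigma>X \<sigma>Y C) - ereal (1 + log 2 (1 / \<epsilon>))"
  shows "\<exists>\<alpha> \<beta> \<Lambda>. mac_code C M1 M2 (49 * sqrt \<epsilon>) \<alpha> \<beta> \<Lambda>"
proof -
  note p = assms(4,5) and q = assms(6,7) and \<epsilon> = assms(8)
  have M: "M1 > 0" "M2 > 0" "0 < real M1" "0 < real M2" "0 < real M1 * real M2" using assms(10,11) by auto
  define \<rho> where "\<rho> = (\<lambda>x y. C (tensor (\<sigma>X x) (\<sigma>Y y)))"
  have den: "density (\<rho> x y)" for x y
    unfolding \<rho>_def using assms(2,3)
    by (intro quantum_channel_density[OF assms(1)] density_tensor) simp_all
  have tr: "trace (\<rho> x y) = 1" for x y using den by (simp add: density_def)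
  show ?thesis
  proof (cases "49 * sqrt \<epsilon> \<ge> 1")
    case True
    then show ?thesis using assms(2,3,10,11) den unfolding \<rho>_def by (intro trivial_code) auto
  next
    case False
    define s where "s = sqrt \<epsilon>"
    have s: "0 < s" "49 * s < 1" "s\<^sup>2 = \<epsilon>" using False \<epsilon> by (auto simp: s_def)
    \<comment> \<open>With \<open>\<delta>\<close> squared equal to \<open>4 s\<close>, the terms of
      order \<open>\<epsilon> / \<delta>^2\<close> and \<open>\<delta>^2\<close> are both of order
      \<open>s\<close>. The case assumption \<open>49 * s < 1\<close> ensures
      \<open>\<delta> \<le> 1\<close>.\<close>
    define \<delta> where "\<delta> = sqrt (4 * s)"
    have \<delta>2: "\<delta>\<^sup>2 = 4 * s" using s by (simp add: \<delta>_def)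
    have \<delta>: "0 < \<delta>" "\<delta> \<le> 1" using s by (auto simp: \<delta>_def)
    have state: "mac_state p q \<sigma>X \<sigma>Y C = cqq p q \<rho>"
      by (simp add: mac_state_eq_cqq \<rho>_def)
    \<comment> \<open>Exchanging the registers reduces the second mutual information to the form of
      the first. For this reason \<open>T2\<close> takes its \<open>y\<close> argument
      first.\<close>
    have swap: "(\<lambda>(y, x, z) (y', x', z'). cqq p q \<rho> (x, y, z) (x', y', z')) = cqq q p (\<lambda>y x. \<rho> x y)"
      by (auto simp: cqq_def fun_eq_iff mult_ac)
    \<comment> \<open>For the third mutual information the pair of letters counts as a single
      letter.\<close>
    have pair: "(\<lambda>((x, y), z) ((x', y'), z'). cqq p q \<rho> (x, y, z) (x', y', z'))
        = cq (\<lambda>(x, y). p x * q y) (\<lambda>(x, y). \<rho> x y)"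
      by (auto simp: cqq_def cq_def fun_eq_iff)
    obtain T1 where T1: "\<forall>x y. psd (T1 x y) \<and> psd (opminus idop (T1 x y))"
      and c1: "1 - \<epsilon> \<le> (\<Sum>x\<in>UNIV. \<Sum>y\<in>UNIV. p x * q y * Tr (T1 x y) (\<rho> x y))"
      and d1: "real M1 * (\<Sum>x'\<in>UNIV. \<Sum>y\<in>UNIV. p x' * q y * (\<Sum>x\<in>UNIV. p x * Tr (T1 x' y) (\<rho> x y))) \<le> \<epsilon>"
      by (rule cqq_test[OF tr q(2) assms(12)[unfolded state IH_X_YZ_def] \<epsilon> M(3)])
    obtain T2 where T2: "\<forall>y x. psd (T2 y x) \<and> psd (opminus idop (T2 y x))"
      and c2: "1 - \<epsilon> \<le> (\<Sum>y\<in>UNIV. \<Sum>x\<in>UNIV. q y * p x * Tr (T2 y x) (\<rho> x y))"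
      and d2: "real M2 * (\<Sum>y'\<in>UNIV. \<Sum>x\<in>UNIV. q y' * p x * (\<Sum>y\<in>UNIV. q y * Tr (T2 y' x) (\<rho> x y))) \<le> \<epsilon>"
      by (rule cqq_test[OF tr p(2) assms(13)[unfolded state IH_Y_XZ_def swap Let_def] \<epsilon> M(4)])
    have "log 2 (real M1 * real M2) = log 2 M1 + log 2 M2"
      using M by (simp add: log_mult)
    then have le3: "ereal (log 2 (real M1 * real M2)) \<le> IH_XY_Z \<epsilon> (cqq p q \<rho>) - ereal (1 + log 2 (1 / \<epsilon>))"
      using assms(14) by (simp only: state)
    have tr3: "trace (case k of (x, y) \<Rightarrow> \<rho> x y) = 1" for k
      by (cases k) (simp add: tr)
    obtain T3 where T3: "\<forall>k. psd (T3 k) \<and> psd (opminus idop (T3 k))"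
      and c3: "1 - \<epsilon> \<le> (\<Sum>k\<in>UNIV. (case k of (x, y) \<Rightarrow> p x * q y) * Tr (T3 k) (case k of (x, y) \<Rightarrow> \<rho> x y))"
      and d3: "real M1 * real M2 * (\<Sum>k'\<in>UNIV. (case k' of (x, y) \<Rightarrow> p x * q y) * (\<Sum>k\<in>UNIV.
          (case k of (x, y) \<Rightarrow> p x * q y) * Tr (T3 k') (case k of (x, y) \<Rightarrow> \<rho> x y))) \<le> \<epsilon>"
      by (rule cq_test[OF tr3 le3[unfolded IH_XY_Z_def pair Let_def] \<epsilon> M(5)])
    define mean where "mean = (\<lambda>\<phi>. \<Sum>x\<in>UNIV. p x * (\<Sum>y\<in>UNIV. q y * \<phi> x y))"
    have mean_add: "mean (\<lambda>x y. \<phi> x y + \<psi> x y) = mean \<phi> + mean \<psi>" for \<phi> \<psi> :: "'x \<Rightarrow> 'y \<Rightarrow> real"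
      by (simp add: mean_def distrib_left sum.distrib)
    have mean_cmult: "mean (\<lambda>x y. c * \<phi> x y) = c * mean \<phi>" for \<phi> :: "'x \<Rightarrow> 'y \<Rightarrow> real" and c
      by (simp add: mean_def sum_distrib_left mult_ac)
    have mean_const: "mean (\<lambda>x y. c) = c" for c
      using p(2) q(2) by (simp add: mean_def flip: sum_distrib_right)
    have mean_compl: "mean (\<lambda>x y. 1 - \<phi> x y) = 1 - mean \<phi>" for \<phi> :: "'x \<Rightarrow> 'y \<Rightarrow> real"
      using mean_add[of "\<lambda>_ _. 1" "\<lambda>x y. (-1) * \<phi> x y"] mean_cmult[of "-1" \<phi>] mean_const[of 1] by simp
    have m1: "1 - mean (\<lambda>x y. Tr (T1 x y) (\<rho> x y)) \<le> \<epsilon>"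
      using c1 by (simp add: mean_def sum_distrib_left mult_ac)
    have m2: "1 - mean (\<lambda>x y. Tr (T2 y x) (\<rho> x y)) \<le> \<epsilon>"
      using c2 by (subst (asm) sum.swap) (simp add: mean_def sum_distrib_left mult_ac)
    have m3: "1 - mean (\<lambda>x y. Tr (T3 (x, y)) (\<rho> x y)) \<le> \<epsilon>"
      using c3 unfolding UNIV_Times_UNIV[symmetric] sum.cartesian_product'
      by (simp add: mean_def sum_distrib_left mult_ac)
    \<comment> \<open>\<open>h\<close> collects the part of the error bound that depends on the
      transmitted letters alone, and \<open>H0\<close> bounds its mean.\<close>
    define h where "h = (\<lambda>x y. 8 * (6 / \<delta>\<^sup>2 * (1 - Tr (T3 (x, y)) (\<rho> x y))
          + 2 * (1 + \<delta>\<^sup>2)\<^sup>2 / \<delta>\<^sup>2 * ((1 - Tr (T1 x y) (\<rho> x y)) + (1 - Tr (T2 y x) (\<rho> x y)))) + 4 * \<delta>\<^sup>2)"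
    define H0 where "H0 = 8 * (6 / \<delta>\<^sup>2 * \<epsilon> + 2 * (1 + \<delta>\<^sup>2)\<^sup>2 / \<delta>\<^sup>2 * (\<epsilon> + \<epsilon>)) + 4 * \<delta>\<^sup>2"
    have "mean h \<le> H0"
    proof -
      have "mean h = 8 * (6 / \<delta>\<^sup>2 * (1 - mean (\<lambda>x y. Tr (T3 (x, y)) (\<rho> x y)))
          + 2 * (1 + \<delta>\<^sup>2)\<^sup>2 / \<delta>\<^sup>2 * ((1 - mean (\<lambda>x y. Tr (T1 x y) (\<rho> x y)))
            + (1 - mean (\<lambda>x y. Tr (T2 y x) (\<rho> x y))))) + 4 * \<delta>\<^sup>2"
        by (simp only: h_def mean_add mean_cmult mean_const mean_compl)
      also have "\<dots> \<le> H0"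
        unfolding H0_def using m1 m2 m3 by (intro add_mono mult_left_mono) auto
      finally show ?thesis .
    qed
    then have H: "(\<Sum>x\<in>UNIV. p x * (\<Sum>y\<in>UNIV. q y * h x y)) \<le> H0" by (simp add: mean_def)
    have nn: "Tr (T1 x' y') (\<rho> x y) \<ge> 0" "Tr (T2 y' x') (\<rho> x y) \<ge> 0" "Tr (T3 k) (\<rho> x y) \<ge> 0" for x' x y' y k
      using T1 T2 T3 den[of x y] unfolding density_def by (blast intro: Tr_nonneg)+
    have A1: "real M1 * (\<Sum>x'\<in>UNIV. \<Sum>x\<in>UNIV. p x' * p x * (\<Sum>y\<in>UNIV. q y * Tr (T1 x' y) (\<rho> x y))) \<le> \<epsilon>"
    proof -
      have "(\<Sum>x\<in>UNIV. p x' * p x * (\<Sum>y\<in>UNIV. q y * Tr (T1 x' y) (\<rho> x y)))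
          = (\<Sum>y\<in>UNIV. p x' * q y * (\<Sum>x\<in>UNIV. p x * Tr (T1 x' y) (\<rho> x y)))" for x'
        unfolding sum_distrib_left by (subst sum.swap) (simp add: mult_ac)
      then show ?thesis using d1 by simp
    qed
    have A2: "real M2 * (\<Sum>x\<in>UNIV. p x * (\<Sum>y'\<in>UNIV. \<Sum>y\<in>UNIV. q y' * q y * Tr (T2 y' x) (\<rho> x y))) \<le> \<epsilon>"
    proof -
      have "(\<Sum>x\<in>UNIV. p x * (\<Sum>y'\<in>UNIV. \<Sum>y\<in>UNIV. q y' * q y * Tr (T2 y' x) (\<rho> x y)))
          = (\<Sum>y'\<in>UNIV. \<Sum>x\<in>UNIV. q y' * p x * (\<Sum>y\<in>UNIV. q y * Tr (T2 y' x) (\<rho> x y)))"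
        unfolding sum_distrib_left by (subst sum.swap) (simp add: mult_ac)
      then show ?thesis using d2 by simp
    qed
    have A3: "real M1 * real M2 * (\<Sum>x'\<in>UNIV. \<Sum>x\<in>UNIV. p x' * p x *
        (\<Sum>y'\<in>UNIV. \<Sum>y\<in>UNIV. q y' * q y * Tr (T3 (x', y')) (\<rho> x y))) \<le> \<epsilon>"
    proof -
      have "(\<Sum>x\<in>UNIV. p x' * p x * (\<Sum>y'\<in>UNIV. \<Sum>y\<in>UNIV. q y' * q y * Tr (T3 (x', y')) (\<rho> x y)))
          = (\<Sum>y'\<in>UNIV. p x' * q y' * (\<Sum>x\<in>UNIV. \<Sum>y\<in>UNIV. p x * q y * Tr (T3 (x', y')) (\<rho> x y)))" for x'
        unfolding sum_distrib_left by (subst sum.swap) (simp add: mult_ac)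
      then show ?thesis using d3 unfolding UNIV_Times_UNIV[symmetric] sum.cartesian_product' by simp
    qed
    obtain f g where fg: "1 / (real M1 * real M2) * (\<Sum>m1<M1. \<Sum>m2<M2. h (f m1) (g m2)
        + 8 * (1 + \<delta>\<^sup>2) * ((\<Sum>j\<in>{..<M1} - {m1}. Tr (T1 (f j) (g m2)) (\<rho> (f m1) (g m2)))
          + (\<Sum>k\<in>{..<M2} - {m2}. Tr (T2 (g k) (f m1)) (\<rho> (f m1) (g m2)))
          + (\<Sum>j\<in>{..<M1} - {m1}. \<Sum>k\<in>{..<M2} - {m2}. Tr (T3 (f j, g k)) (\<rho> (f m1) (g m2)))))
      \<le> H0 + 3 * (8 * (1 + \<delta>\<^sup>2)) * \<epsilon>"
      using random_codebook[OF p q M(1,2) _ _ _ _ H A1 A2 A3, of "8 * (1 + \<delta>\<^sup>2)"] nn by auto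
    obtain \<Lambda> where \<Lambda>: "\<And>m1 m2. m1 < M1 \<Longrightarrow> m2 < M2 \<Longrightarrow> psd (\<Lambda> m1 m2)"
      and tot: "\<And>i j. (\<Sum>m1<M1. \<Sum>m2<M2. \<Lambda> m1 m2 i j) = idop i j"
      and err: "\<And>m1 m2 \<rho>. m1 < M1 \<Longrightarrow> m2 < M2 \<Longrightarrow> density \<rho> \<Longrightarrow> Tr (opminus idop (\<Lambda> m1 m2)) \<rho>
        \<le> 8 * (6 / \<delta>\<^sup>2 * (1 - Tr (T3 (f m1, g m2)) \<rho>)
          + 2 * (1 + \<delta>\<^sup>2)\<^sup>2 / \<delta>\<^sup>2 * ((1 - Tr (T1 (f m1) (g m2)) \<rho>) + (1 - Tr (T2 (g m2) (f m1)) \<rho>))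
          + (1 + \<delta>\<^sup>2) * ((\<Sum>j\<in>{..<M1} - {m1}. Tr (T1 (f j) (g m2)) \<rho>)
              + (\<Sum>k\<in>{..<M2} - {m2}. Tr (T2 (g k) (f m1)) \<rho>)
              + (\<Sum>j\<in>{..<M1} - {m1}. \<Sum>k\<in>{..<M2} - {m2}. Tr (T3 (f j, g k)) \<rho>)))
        + 4 * \<delta>\<^sup>2"
      using codebook_decoder[of "\<lambda>j k. T1 (f j) (g k)" "\<lambda>j k. T2 (g k) (f j)" "\<lambda>j k. T3 (f j, g k)",
          OF T1[rule_format] T2[rule_format] T3[rule_format] M(1,2) \<delta>] by blast
    have "1 / (real M1 * real M2) * (\<Sum>m1<M1. \<Sum>m2<M2. Tr (opminus idop (\<Lambda> m1 m2)) (\<rho> (f m1) (g m2)))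
        \<le> H0 + 3 * (8 * (1 + \<delta>\<^sup>2)) * \<epsilon>"
    proof (rule order_trans[OF _ fg], intro mult_left_mono sum_mono)
      fix m1 m2 assume "m1 \<in> {..<M1}" "m2 \<in> {..<M2}"
      then have m: "m1 < M1" "m2 < M2" by auto
      show "Tr (opminus idop (\<Lambda> m1 m2)) (\<rho> (f m1) (g m2)) \<le> h (f m1) (g m2)
        + 8 * (1 + \<delta>\<^sup>2) * ((\<Sum>j\<in>{..<M1} - {m1}. Tr (T1 (f j) (g m2)) (\<rho> (f m1) (g m2)))
          + (\<Sum>k\<in>{..<M2} - {m2}. Tr (T2 (g k) (f m1)) (\<rho> (f m1) (g m2)))
          + (\<Sum>j\<in>{..<M1} - {m1}. \<Sum>k\<in>{..<M2} - {m2}. Tr (T3 (f j, g k)) (\<rho> (f m1) (g m2))))"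
        using err[OF m den[of "f m1" "g m2"]] unfolding h_def mult.assoc[of 8 "1 + \<delta>\<^sup>2"]
        by (simp only: distrib_left[of "8::real"] add_ac)
    qed simp
    also have "\<dots> \<le> 49 * s"
    proof -
      have ss: "s * s \<le> s * (1 / 49)" using s by (intro mult_left_mono) auto
      have "s * s * s \<le> s * (1 / 49) * (1 / 49)" using s by (intro mult_mono ss) auto
      \<comment> \<open>The leading \<open>36 s\<close> consists of \<open>12 s\<close> from
        \<open>T3\<close>, \<open>8 s\<close> from \<open>T1\<close> and \<open>T2\<close>, and
        \<open>16 s\<close> from undoing the tilt. The competitors enter only at order
        \<open>s^2\<close>, and all higher orders are small since \<open>s < 1 / 49\<close>.\<close>
      moreover have "H0 + 3 * (8 * (1 + \<delta>\<^sup>2)) * \<epsilon> = 36 * s + 88 * (s * s) + 224 * (s * s * s)"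
        unfolding H0_def \<delta>2 s(3)[symmetric] using s(1)
        by (simp add: field_simps power2_eq_square)
      ultimately show ?thesis using s ss by linarith
    qed
    finally have "mac_code C M1 M2 (49 * sqrt \<epsilon>) (\<lambda>m. \<sigma>X (f m)) (\<lambda>m. \<sigma>Y (g m)) \<Lambda>"
      using assms(2,3) \<Lambda> tot by (simp add: mac_code_def Tr_def \<rho>_def s_def)
    then show ?thesis by blast
  qed
qed

end
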